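(* Let $B$ be a unital separable $C^*$-algebra. Then the following statements hold. (i) Let $M\subset B$ be a unital norm-closed subspace. Let $\mathcal{P}(M)$ denote the set of pure states $\omega$ on $B$ such that $E_\omega=\{\psi\in\mathcal{S}(B):\psi|_M=\omega|_M\}$ contains a non-empty $M$-peak set. Then the set $\{\omega|_M:\omega\in\mathcal{P}(M)\}$ is weak-$*$ dense in the pure states on $M$. (ii) Let $A\subset B$ be a unital norm-closed subalgebra. Let $\mathcal{P}(\mathcal{Q}(A))$ denote the set of pure states $\omega$ on $B$ such that $E_\omega=\{\psi\in\mathcal{S}(B):\psi|_A=\omega|_A\}$ contains a non-empty $\mathcal{Q}(A)$-peak set. Then $$\sup_{\omega\in\mathcal{P}(\mathcal{Q}(A))}\omega(a^*a)=\|a\|^2$$ for every $a\in A$.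
   Context: A unital subspace (or subalgebra) of $B$ is a complex linear subspace (subalgebra, not necessarily self-adjoint) containing the unit $I$ of $B$. A state on a unital subspace $M$ is a contractive linear functional $\phi:M\to\mathbb{C}$ with $\phi(I)=1$; $\mathcal{S}(M)$ is the convex set of all states on $M$, with the weak-$*$ topology, and a state is pure if it is an extreme point of $\mathcal{S}(M)$. For a subset $X\subset B$, a subset $E\subset\mathcal{S}(B)$ is an $X$-peak set if there is $x\in X$ such that $\phi(x)=1$ for every $\phi\in E$, while $|\psi(x)|<1$ for every $\psi\in\mathcal{S}(B)\setminus E$. For a unital subspace $M\subset B$, $\mathcal{Q}(M)=\{a^*a:a\in M\}$. *)

theory Defs
  imports "HOL-Analysis.Analysis"
begin

text \<open>
  Unital \<open>C\<^sup>*\<close>-algebras as a type class. The parent class \<open>real_normed_algebra_1\<close> provides a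
  submultiplicative norm with \<open>norm 1 = 1\<close>, so the zero algebra is excluded. As it brings its own
  real scalar multiplication, \<open>scaleR_eq_scaleC\<close> ties the latter to the complex one.
\<close>

class unital_cstar_algebra = real_normed_algebra_1 + banach +
  fixes scaleC :: "complex \<Rightarrow> 'a \<Rightarrow> 'a" (infixr \<open>*\<^sub>C\<close> 75)
    and adj :: "'a \<Rightarrow> 'a"
  assumes scaleC_add_right: "c *\<^sub>C (x + y) = c *\<^sub>C x + c *\<^sub>C y"
    and scaleC_add_left: "(c + d) *\<^sub>C x = c *\<^sub>C x + d *\<^sub>C x"
    and scaleC_scaleC: "c *\<^sub>C d *\<^sub>C x = (c * d) *\<^sub>C x"
    and scaleC_one: "1 *\<^sub>C x = x"
    and scaleR_eq_scaleC: "r *\<^sub>R x = complex_of_real r *\<^sub>C x"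
    and mult_scaleC_left: "(c *\<^sub>C x) * y = c *\<^sub>C (x * y)"
    and mult_scaleC_right: "x * (c *\<^sub>C y) = c *\<^sub>C (x * y)"
    and norm_scaleC: "norm (c *\<^sub>C x) = cmod c * norm x"
    and adj_adj: "adj (adj x) = x"
    and adj_add: "adj (x + y) = adj x + adj y"
    and adj_scaleC: "adj (c *\<^sub>C x) = cnj c *\<^sub>C adj x"
    and adj_mult: "adj (x * y) = adj y * adj x"
    and cstar_identity: "norm (adj x * x) = (norm x)\<^sup>2"

instantiation complex :: unital_cstar_algebra
begin

definition scaleC_complex :: "complex \<Rightarrow> complex \<Rightarrow> complex"
  where "scaleC_complex c x = c * x"

definition adj_complex :: "complex \<Rightarrow> complex"
  where "adj_complex x = cnj x"

instance
  by standard
    (simp_all add: scaleC_complex_def adj_complex_def algebra_simps scaleR_conv_of_real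
      norm_mult power2_eq_square)

end

global_interpretation complex_vector:
  vector_space "scaleC :: complex \<Rightarrow> 'a \<Rightarrow> 'a::unital_cstar_algebra"
  by standard (simp_all add: scaleC_add_right scaleC_add_left scaleC_scaleC scaleC_one)

definition unital_subspace :: "'b::unital_cstar_algebra set \<Rightarrow> bool"
  where "unital_subspace M \<longleftrightarrow> complex_vector.subspace M \<and> 1 \<in> M"

definition unital_subalgebra :: "'b::unital_cstar_algebra set \<Rightarrow> bool"
  where "unital_subalgebra A \<longleftrightarrow> unital_subspace A \<and> (\<forall>x\<in>A. \<forall>y\<in>A. x * y \<in> A)"

text \<open>
  A functional on \<open>M\<close> is represented by a function that is \<open>undefined\<close> outside \<open>M\<close>, so equality of
  functions is equality of functionals. States on the whole algebra are \<open>states UNIV\<close>, and the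
  restriction of \<open>\<omega>\<close> to \<open>M\<close> is \<open>restrict \<omega> M\<close>.
\<close>

definition states :: "'b::unital_cstar_algebra set \<Rightarrow> ('b \<Rightarrow> complex) set"
  where "states M =
    {\<phi> \<in> extensional M.
       (\<forall>x\<in>M. \<forall>y\<in>M. \<phi> (x + y) = \<phi> x + \<phi> y) \<and>
       (\<forall>c. \<forall>x\<in>M. \<phi> (c *\<^sub>C x) = c * \<phi> x) \<and>
       (\<forall>x\<in>M. cmod (\<phi> x) \<le> norm x) \<and>
       \<phi> 1 = 1}"

text \<open>The topology of pointwise convergence on \<open>M\<close>.\<close>

definition weak_star :: "'b::unital_cstar_algebra set \<Rightarrow> ('b \<Rightarrow> complex) topology"
  where "weak_star M = subtopology (product_topology (\<lambda>_. euclidean) M) (states M)"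

text \<open>
  The extreme points of \<open>states M\<close>. The constant \<open>extreme_point_of\<close> does not apply, since function
  types are not an instance of \<open>real_vector\<close>.
\<close>

definition pure_states :: "'b::unital_cstar_algebra set \<Rightarrow> ('b \<Rightarrow> complex) set"
  where "pure_states M =
    {\<phi> \<in> states M.
       \<forall>\<psi>\<^sub>1\<in>states M. \<forall>\<psi>\<^sub>2\<in>states M. \<forall>t::real.
         0 < t \<longrightarrow> t < 1 \<longrightarrow>
         (\<forall>x\<in>M. \<phi> x = complex_of_real t * \<psi>\<^sub>1 x + complex_of_real (1 - t) * \<psi>\<^sub>2 x) \<longrightarrow>
         \<psi>\<^sub>1 = \<phi> \<and> \<psi>\<^sub>2 = \<phi>}"

definition peak_set :: "'b::unital_cstar_algebra set \<Rightarrow> ('b \<Rightarrow> complex) set \<Rightarrow> bool"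
  where "peak_set X E \<longleftrightarrow>
    E \<subseteq> states UNIV \<and>
    (\<exists>x\<in>X. (\<forall>\<phi>\<in>E. \<phi> x = 1) \<and> (\<forall>\<psi>\<in>states UNIV - E. cmod (\<psi> x) < 1))"

definition state_extensions ::
    "'b::unital_cstar_algebra set \<Rightarrow> ('b \<Rightarrow> complex) \<Rightarrow> ('b \<Rightarrow> complex) set"
  where "state_extensions M \<omega> = {\<psi> \<in> states UNIV. restrict \<psi> M = restrict \<omega> M}"

definition squares :: "'b::unital_cstar_algebra set \<Rightarrow> 'b set"
  where "squares M = {adj a * a | a. a \<in> M}"

text \<open>
  \<open>peaking_states X M\<close> is the set \<open>\<P>(X)\<close>, where the extensions are taken relative to the
  restriction to \<open>M\<close>; the cases of interest are \<open>X = M\<close> and \<open>X = squares M\<close>.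
\<close>

definition peaking_states ::
    "'b::unital_cstar_algebra set \<Rightarrow> 'b set \<Rightarrow> ('b \<Rightarrow> complex) set"
  where "peaking_states X M =
    {\<omega> \<in> pure_states UNIV. \<exists>E. E \<noteq> {} \<and> peak_set X E \<and> E \<subseteq> state_extensions M \<omega>}"

end

theory Submission
  imports Defs
begin

text \<open>
  Both statements come from the same device. Let \<open>K\<close> be a weak-\<open>*\<close> compact set of contractive
  functionals, \<open>M\<close> a closed subspace and \<open>x\<^sub>0 \<in> M\<close>. Then \<open>M\<close> contains elements \<open>x\<close> arbitrarily close to
  \<open>x\<^sub>0\<close> for which \<open>Re (f x)\<close> attains its maximum over \<open>K\<close> at functionals \<open>f\<close> having one common
  restriction to \<open>M\<close> (\<open>exposing_element_near\<close>). This replaces Mazur's theorem on the density of smooth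
  points, and it has a short proof: fix a sequence \<open>d\<close> in the unit ball of \<open>M\<close> that separates
  functionals on \<open>M\<close>, let \<open>|f - g|\<^sup>2 = \<Sum>n. 2\<^sup>-\<^sup>n |f (d n) - g (d n)|\<^sup>2\<close>, and maximise
  \<open>Re (f x\<^sub>0) + \<delta> |f|\<^sup>2\<close> over \<open>K\<close>. Linearising the square at a maximiser \<open>g\<close> costs exactly
  \<open>\<delta> |f - g|\<^sup>2\<close>, and the linear part is evaluation at an element of \<open>M\<close>; so \<open>g\<close> maximises the perturbed
  element, strictly up to functionals agreeing with \<open>g\<close> on \<open>M\<close>. The same square norm yields
  pure states in compact faces (take \<open>M\<close> to be the whole algebra) and, by minimising a distance,
  strict separation of a functional from a compact convex set by an element of \<open>M\<close>.

  For the first statement take \<open>K\<close> to be all unimodular multiples of states. Maximal real part on \<open>K\<close>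
  is maximal modulus on states, so after normalisation \<open>x\<close> peaks exactly on the extensions of one
  state on \<open>M\<close>. That set is a closed face of the state space and contains a pure state
  (\<open>peaking_state_exists\<close>). For density let \<open>\<phi>\<close> be pure on \<open>M\<close>. The states outside a basic neighbourhood
  of \<open>\<phi>\<close> lie in finitely many half-space slices. As \<open>\<phi>\<close> is extreme, no state in the convex hull of
  these slices extends \<open>\<phi>\<close> (the argument behind Milman's theorem). This hull is compact, so some
  \<open>x\<^sub>1 \<in> M\<close> separates \<open>\<phi>\<close> strictly from it. Peaking elements near \<open>x\<^sub>1 + c\<close>, for a large constant \<open>c\<close>, are
  maximal in modulus only at states where \<open>Re x\<^sub>1\<close> is nearly maximal, hence inside the neighbourhood
  (\<open>peaking_state_outside\<close>). Conversely, restrictions of peaking states are pure because states on \<open>M\<close>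
  extend to the whole algebra.

  For the second statement take \<open>K\<close> to be the unit ball of the dual space. For \<open>a\<close> in a dense subset of
  \<open>A\<close> there is only one contractive functional \<open>f\<close> on \<open>A\<close> attaining \<open>\<parallel>a\<parallel>\<close> at \<open>a\<close>. If \<open>b = a / \<parallel>a\<parallel>\<close> and \<open>\<psi>\<close> is
  a state with \<open>\<psi> (b\<^sup>* b) = 1\<close>, then \<open>w \<mapsto> \<psi> (b\<^sup>* w)\<close> must be this \<open>f\<close> on \<open>A\<close>. Cauchy-Schwarz gives
  \<open>\<psi> y = \<psi> (b\<^sup>* b y) = f (b y)\<close> for \<open>y \<in> A\<close>; here it matters that \<open>A\<close> is an algebra. So \<open>\<psi>\<close> is
  determined on \<open>A\<close>, the square \<open>b\<^sup>* b\<close> peaks on the extensions of one state, and a pure state \<open>\<omega>\<close> among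
  them has \<open>\<omega> (a\<^sup>* a) = \<parallel>a\<parallel>\<^sup>2\<close> (\<open>squares_peaking_state_near\<close>).

  The argument rests on two pieces of general theory: positivity of contractive unital
  functionals on elements \<open>b\<^sup>* b\<close>, obtained from square roots without spectral theory, and
  a norm-preserving Hahn-Banach extension.
\<close>

section \<open>The adjoint and square roots\<close>

lemma adj_zero [simp]: "adj (0::'b::unital_cstar_algebra) = 0"
  using adj_add[of 0 "0::'b"] by simp

lemma adj_minus: "adj (- x) = - adj (x::'b::unital_cstar_algebra)"
  using adj_add[of x "- x"] by (simp add: eq_neg_iff_add_eq_0 add.commute)

lemma adj_diff: "adj (x - y) = adj x - adj (y::'b::unital_cstar_algebra)"
  using adj_add[of x "- y"] by (simp add: adj_minus)

lemma adj_one [simp]: "adj (1::'b::unital_cstar_algebra) = 1"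
  using adj_mult[of "adj 1" "1::'b"] by (simp add: adj_adj)

lemma adj_scaleR: "adj (r *\<^sub>R x) = r *\<^sub>R adj (x::'b::unital_cstar_algebra)"
  by (simp add: scaleR_eq_scaleC adj_scaleC)

lemma norm_adj [simp]: "norm (adj x) = norm (x::'b::unital_cstar_algebra)"
proof -
  have "norm y \<le> norm (adj y)" for y :: 'b
  proof (cases "y = 0")
    case False
    have "norm y * norm y \<le> norm (adj y) * norm y"
      using cstar_identity[of y] norm_mult_ineq[of "adj y" y] by (simp add: power2_eq_square)
    then show ?thesis using False by simp
  qed simp
  from this[of x] this[of "adj x"] show ?thesis by (simp add: adj_adj)
qed

lemma bounded_linear_adj: "bounded_linear (adj :: 'b::unital_cstar_algebra \<Rightarrow> 'b)"
  by (rule bounded_linear_intro[where K = 1]) (simp_all add: adj_add adj_scaleR)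

lemma norm_square_selfadjoint:
  "adj x = x \<Longrightarrow> norm (x * x) = (norm (x::'b::unital_cstar_algebra))\<^sup>2"
  using cstar_identity[of x] by simp

text \<open>
  A selfadjoint \<open>y\<close> with \<open>(1 - y)\<^sup>2 = 1 - x\<close> is a fixed point of \<open>y \<mapsto> (x + y\<^sup>2) / 2\<close>. The iterates from
  \<open>0\<close>, and their successive differences, are dominated in norm by those of the scalar iteration with
  \<open>x = 1\<close>, which increases to \<open>1\<close>. This reaches the boundary case \<open>\<parallel>x\<parallel> = 1\<close>, where the
  iteration is not a contraction. As a limit of polynomials in \<open>x\<close>, the fixed point commutes with
  everything that \<open>x\<close> commutes with.
\<close>

lemma square_root_of_one_minus:
  fixes x :: "'b::unital_cstar_algebra"
  assumes x: "adj x = x" "norm x \<le> 1"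
  obtains y where "adj y = y" "norm y \<le> 1" "(1 - y) * (1 - y) = 1 - x"
    "\<And>z. z * x = x * z \<Longrightarrow> z * y = y * z"
proof -
  define Y :: "nat \<Rightarrow> 'b" where "Y = rec_nat 0 (\<lambda>_ y. (1/2) *\<^sub>R (x + y * y))"
  \<comment> \<open>The same iteration with \<open>x = 1\<close> in the scalars; it majorises the norm of \<open>Y\<close>.\<close>
  define T :: "nat \<Rightarrow> real" where "T = rec_nat 0 (\<lambda>_ t. (1 + t * t) / 2)"
  have Y0: "Y 0 = 0" and YS: "Y (Suc n) = (1/2) *\<^sub>R (x + Y n * Y n)" for n
    by (simp_all add: Y_def)
  have T0: "T 0 = 0" and TS: "T (Suc n) = (1 + T n * T n) / 2" for n
    by (simp_all add: T_def)
  have T01: "0 \<le> T n \<and> T n \<le> 1" for n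
    by (induction n) (auto simp: T0 TS mult_le_one)
  have Tinc: "T n \<le> T (Suc n)" for n
  proof -
    have "0 \<le> (1 - T n)\<^sup>2" by simp
    then show ?thesis by (simp add: TS power2_eq_square algebra_simps)
  qed
  have Tconv: "convergent T"
    by (rule Bseq_mono_convergent[OF BseqI'[where K = 1]])
       (use T01 Tinc in \<open>auto intro: lift_Suc_mono_le\<close>)
  have YT: "norm (Y n) \<le> T n" for n
  proof (induction n)
    case (Suc n)
    have "norm (x + Y n * Y n) \<le> 1 + T n * T n"
      using x(2) Suc norm_mult_ineq[of "Y n" "Y n"] T01[of n]
        mult_mono[of "norm (Y n)" "T n" "norm (Y n)" "T n"]
      by (intro norm_triangle_le) auto
    then show ?case by (simp add: YS TS)
  qed (simp add: Y0 T0)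
  have step: "norm (Y (Suc n) - Y n) \<le> T (Suc n) - T n" for n
  proof (induction n)
    case 0
    then show ?case using YT[of "Suc 0"] by (simp add: Y0 T0)
  next
    case (Suc n)
    let ?d = "Y (Suc n) - Y n"
    have "Y (Suc (Suc n)) - Y (Suc n) = (1/2) *\<^sub>R (Y (Suc n) * ?d + ?d * Y n)"
      unfolding YS[of "Suc n"] YS[of n, symmetric]
      by (subst (2) YS) (simp add: algebra_simps)
    also have "norm \<dots> \<le> (1/2) * (T (Suc n) * (T (Suc n) - T n) + (T (Suc n) - T n) * T n)"
    proof -
      have "norm (Y (Suc n) * ?d) \<le> T (Suc n) * (T (Suc n) - T n)"
        using norm_mult_ineq[of "Y (Suc n)" ?d] mult_mono[OF YT[of "Suc n"] Suc] T01[of "Suc n"]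
        by fastforce
      moreover have "norm (?d * Y n) \<le> (T (Suc n) - T n) * T n"
        using norm_mult_ineq[of ?d "Y n"] mult_mono[OF Suc YT[of n]] Tinc[of n]
        by fastforce
      ultimately have "norm (Y (Suc n) * ?d + ?d * Y n)
          \<le> T (Suc n) * (T (Suc n) - T n) + (T (Suc n) - T n) * T n"
        by (rule norm_triangle_mono)
      then show ?thesis by simp
    qed
    also have "\<dots> = T (Suc (Suc n)) - T (Suc n)"
      unfolding TS[of "Suc n"] by (subst (6) TS) (simp add: field_simps)
    finally show ?case .
  qed
  have "summable (\<lambda>n. Y (Suc n) - Y n)"
  proof (rule summable_comparison_test')
    show "summable (\<lambda>n. T (Suc n) - T n)"
      using telescope_summable Tconv by (auto simp: convergent_def)
  qed (use step in auto)
  then have "(\<lambda>n. \<Sum>i<n. Y (Suc i) - Y i) \<longlonglongrightarrow> (\<Sum>n. Y (Suc n) - Y n)"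
    by (rule summable_LIMSEQ)
  then obtain y where y: "Y \<longlonglongrightarrow> y"
    by (auto simp: sum_lessThan_telescope Y0)
  have "(\<lambda>n. Y (Suc n)) \<longlonglongrightarrow> (1/2) *\<^sub>R (x + y * y)"
    unfolding YS by (intro tendsto_intros y)
  then have eq: "y = (1/2) *\<^sub>R (x + y * y)"
    using LIMSEQ_unique[OF LIMSEQ_Suc[OF y]] by blast
  show ?thesis
  proof
    have "adj (Y n) = Y n" for n
      by (induction n) (simp_all add: Y0 YS adj_scaleR adj_add adj_mult x)
    then show "adj y = y"
      using LIMSEQ_unique[OF y, of "adj y"] bounded_linear.tendsto[OF bounded_linear_adj y] by simp
    show "norm y \<le> 1"
      by (rule LIMSEQ_le_const2[OF tendsto_norm[OF y]]) (use YT T01 in \<open>meson order_trans\<close>)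
    have "2 *\<^sub>R y = x + y * y" by (subst eq) simp
    then show "(1 - y) * (1 - y) = 1 - x"
      by (simp add: algebra_simps scaleR_2)
    fix z assume z: "z * x = x * z"
    have "z * Y n = Y n * z" for n
    proof (induction n)
      case (Suc n)
      have "z * (Y n * Y n) = (Y n * z) * Y n" by (simp add: mult.assoc[symmetric] Suc)
      also have "\<dots> = (Y n * Y n) * z" by (simp add: mult.assoc Suc)
      finally have "z * (Y n * Y n) = (Y n * Y n) * z" .
      then show ?case by (simp add: YS distrib_left distrib_right z)
    qed (simp add: Y0)
    moreover have "(\<lambda>n. z * Y n) \<longlonglongrightarrow> z * y" "(\<lambda>n. Y n * z) \<longlonglongrightarrow> y * z"
      by (intro tendsto_intros y)+
    ultimately show "z * y = y * z" using LIMSEQ_unique by force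
  qed
qed

lemma norm_unitary: 
  assumes "adj u * u = (1::'b::unital_cstar_algebra)" 
  shows "norm u = 1"
  using cstar_identity[of u] assms norm_ge_zero[of u] by (simp add: power2_eq_1_iff)

lemma norm_real_part_le: "norm (x + adj x) \<le> 2 * norm (x::'b::unital_cstar_algebra)"
  using norm_triangle_ineq[of x "adj x"] by simp

lemma adj_mult_commuting_pair:
  fixes s w :: "'b::unital_cstar_algebra"
  assumes "adj s = s" "adj w = w" "s * w = w * s"
  shows "adj (s + \<i> *\<^sub>C w) * (s + \<i> *\<^sub>C w) = s * s + w * w"
  using assms
  by (simp add: adj_add adj_scaleC algebra_simps mult_scaleC_left mult_scaleC_right 
      scaleC_scaleC complex_vector.scale_minus_left scaleC_one)

text \<open>
  With \<open>s = (1 - w\<^sup>2)\<^sup>1\<^sup>/\<^sup>2\<close> the element \<open>u = s + iw\<close> is unitary. The first bound holds because \<open>s\<close> is the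
  real part of \<open>u\<close> and \<open>1 - w\<^sup>2 = s\<^sup>2\<close>, the second because \<open>1 - 2 w\<^sup>2 = s\<^sup>2 - w\<^sup>2\<close> is the real part of \<open>u\<^sup>2\<close>.
\<close>

lemma norm_one_minus_square_le:
  fixes w :: "'b::unital_cstar_algebra"
  assumes w: "adj w = w" "norm w \<le> 1"
  shows "norm (1 - w * w) \<le> 1" and "norm (1 - 2 *\<^sub>R (w * w)) \<le> 1"
proof -
  have "norm (w * w) \<le> 1" using w by (simp add: norm_square_selfadjoint power_le_one)
  then obtain y where y: "adj y = y" "(1 - y) * (1 - y) = 1 - w * w"
    and com: "\<And>z. z * (w * w) = (w * w) * z \<Longrightarrow> z * y = y * z"
    using square_root_of_one_minus[of "w * w"] w by (metis adj_mult)
  define s where "s = 1 - y"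
  have s: "adj s = s" "s * s = 1 - w * w" using y by (simp_all add: s_def adj_diff)
  have sw: "s * w = w * s" using com[of w] by (simp add: s_def algebra_simps mult.assoc)
  define u where "u = s + \<i> *\<^sub>C w"
  have u: "adj u * u = 1"
    unfolding u_def using adj_mult_commuting_pair[OF s(1) w(1) sw] s(2) by simp
  have nu: "norm u = 1" by (rule norm_unitary[OF u])
  have adju: "adj u = s - \<i> *\<^sub>C w"
    by (simp add: u_def adj_add adj_scaleC s w complex_vector.scale_minus_left)
  have "norm (2 *\<^sub>R s) \<le> 2"
    using norm_real_part_le[of u] nu by (simp add: adju scaleR_2) (simp add: u_def)
  then have "norm s \<le> 1" by simp
  then show "norm (1 - w * w) \<le> 1"
    using norm_square_selfadjoint[OF s(1)] by (simp add: s(2)[symmetric] power_le_one)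
  have "u * u + adj (u * u) = 2 *\<^sub>R (s * s - w * w)"
    by (simp add: adj_mult adju)
      (simp add: u_def algebra_simps mult_scaleC_left mult_scaleC_right scaleC_scaleC
        complex_vector.scale_minus_left scaleC_one scaleR_2)
  then have "norm (2 *\<^sub>R (s * s - w * w)) \<le> 2 * norm (u * u)"
    using norm_real_part_le[of "u * u"] by simp
  also have "norm (u * u) \<le> 1" using norm_mult_ineq[of u u] nu by simp
  finally have "norm (s * s - w * w) \<le> 1" by simp
  then show "norm (1 - 2 *\<^sub>R (w * w)) \<le> 1"
    by (simp add: s(2) scaleR_2 diff_diff_eq)
qed

text \<open>
  Positivity is encoded by a selfadjoint square root, the form in which it is produced and consumed below.
\<close>

definition positive_elements :: "'b::unital_cstar_algebra set" where
  "positive_elements = {w * w | w. adj w = w}"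

lemma positive_elements_selfadjoint: "h \<in> positive_elements \<Longrightarrow> adj h = h"
  by (auto simp: positive_elements_def adj_mult)

lemma positive_elements_scaleR:
  assumes "h \<in> positive_elements" "0 \<le> r"
  shows "r *\<^sub>R h \<in> positive_elements"
proof -
  obtain w where "adj w = w" "h = w * w" using assms by (auto simp: positive_elements_def)
  then have "adj (sqrt r *\<^sub>R w) = sqrt r *\<^sub>R w" "r *\<^sub>R h = (sqrt r *\<^sub>R w) * (sqrt r *\<^sub>R w)"
    using assms(2) by (simp_all add: adj_scaleR)
  then show ?thesis unfolding positive_elements_def by blast
qed

lemma square_root_commuting:
  fixes h :: "'b::unital_cstar_algebra"
  assumes "adj h = h" "norm (1 - h) \<le> 1"
  obtains w where "adj w = w" "w * w = h" "norm (1 - w) \<le> 1"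
    "\<And>z. z * h = h * z \<Longrightarrow> z * w = w * z"
proof -
  obtain y where y: "adj y = y" "norm y \<le> 1" "(1 - y) * (1 - y) = 1 - (1 - h)"
    "\<And>z. z * (1 - h) = (1 - h) * z \<Longrightarrow> z * y = y * z"
    using square_root_of_one_minus[of "1 - h"] assms by (auto simp: adj_diff)
  show ?thesis
  proof (rule that[of "1 - y"])
    fix z assume "z * h = h * z"
    then have "z * y = y * z" by (intro y(4)) (simp add: algebra_simps)
    then show "z * (1 - y) = (1 - y) * z" by (simp add: algebra_simps)
  qed (use y in \<open>auto simp: adj_diff\<close>)
qed

lemma positive_elements_norm_le:
  assumes "h \<in> positive_elements" "norm h \<le> 1"
  shows "norm (1 - h) \<le> 1" and "norm (1 - 2 *\<^sub>R h) \<le> 1"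
proof -
  obtain w where w: "adj w = w" "h = w * w" using assms by (auto simp: positive_elements_def)
  then have "norm w \<le> 1"
    using assms(2) by (simp add: norm_square_selfadjoint power_le_one_iff)
  then show "norm (1 - h) \<le> 1" "norm (1 - 2 *\<^sub>R h) \<le> 1"
    using norm_one_minus_square_le w by auto
qed

text \<open>
  After scaling, both summands lie within distance \<open>1\<close> of \<open>1\<close>. So does their average, and a selfadjoint
  element within distance \<open>1\<close> of \<open>1\<close> has a square root.
\<close>

lemma positive_elements_add:
  fixes h k :: "'b::unital_cstar_algebra"
  assumes "h \<in> positive_elements" "k \<in> positive_elements"
  shows "h + k \<in> positive_elements"
proof -
  define t where "t = norm h + norm k + 1"
  have t: "t > 0" by (simp add: t_def add_nonneg_pos)
  have "norm ((1/t) *\<^sub>R h) \<le> 1" "norm ((1/t) *\<^sub>R k) \<le> 1"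
    using t by (simp_all add: t_def)
  then have "norm (1 - (1/t) *\<^sub>R h) \<le> 1" "norm (1 - (1/t) *\<^sub>R k) \<le> 1"
    using t assms by (auto intro!: positive_elements_norm_le(1) positive_elements_scaleR)
  then have "norm ((1 - (1/t) *\<^sub>R h) + (1 - (1/t) *\<^sub>R k)) \<le> 1 + 1"
    by (rule norm_triangle_mono)
  moreover have "(1 - (1/t) *\<^sub>R h) + (1 - (1/t) *\<^sub>R k) = 2 *\<^sub>R (1 - (1/(2*t)) *\<^sub>R (h + k))"
    by (simp add: algebra_simps scaleR_2)
  ultimately have "norm (1 - (1/(2*t)) *\<^sub>R (h + k)) \<le> 1"
    by (metis norm_scaleR abs_numeral one_add_one mult_le_cancel_left_pos mult.right_neutral zero_less_numeral)
  moreover have "adj ((1/(2*t)) *\<^sub>R (h + k)) = (1/(2*t)) *\<^sub>R (h + k)"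
    using assms by (simp add: adj_scaleR adj_add positive_elements_selfadjoint)
  ultimately have "(1/(2*t)) *\<^sub>R (h + k) \<in> positive_elements"
    using square_root_commuting unfolding positive_elements_def mem_Collect_eq by metis
  from positive_elements_scaleR[OF this, of "2 * t"] t show ?thesis by simp
qed

lemma norm_power_selfadjoint:
  fixes x :: "'b::unital_cstar_algebra"
  assumes "adj x = x"
  shows "norm (x ^ (2 ^ m)) = norm x ^ (2 ^ m)"
proof (induction m)
  case (Suc m)
  have "adj (x ^ n) = x ^ n" for n
  proof (induction n)
    case (Suc n)
    then show ?case by (metis adj_mult assms power_Suc power_commutes)
  qed simp
  then have "norm (x ^ (2 ^ m) * x ^ (2 ^ m)) = (norm (x ^ (2 ^ m)))\<^sup>2"
    by (intro norm_square_selfadjoint)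
  then show ?case using Suc by (simp add: power_add[symmetric] mult_2 power2_eq_square)
qed simp

text \<open>
  A substitute for the spectral radius formula: along exponents \<open>2\<^sup>m\<close> the norm of a selfadjoint element is
  multiplicative, so linear growth of the norms of its powers excludes \<open>\<parallel>x\<parallel> > 1\<close>.
\<close>

lemma norm_power_linear_growth_imp:
  fixes x :: "'b::unital_cstar_algebra"
  assumes "adj x = x" "\<And>n. norm (x ^ n) \<le> 1 + real n * C"
  shows "norm x \<le> 1"
proof (rule ccontr)
  assume "\<not> norm x \<le> 1"
  then have r: "norm x > 1" by simp
  then have r1: "1 / norm x < 1" by (subst divide_less_eq) auto
  have "filterlim (\<lambda>n. 2 ^ n :: nat) at_top sequentially"
    by (rule filterlim_subseq) (simp add: strict_mono_def)
  moreover have "(\<lambda>n. (1 + real n * C) / norm x ^ n) \<longlonglongrightarrow> 0"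
  proof -
    have "(\<lambda>n. (1 / norm x) ^ n) \<longlonglongrightarrow> 0" using r1 by (intro LIMSEQ_realpow_zero) auto
    moreover have "(\<lambda>n. real n * (1 / norm x) ^ n) \<longlonglongrightarrow> 0"
    proof (rule powser_times_n_limit_0)
      show "norm (1 / norm x) < 1"
        by (subst real_norm_def, subst abs_of_nonneg) (use r1 in auto)
    qed
    ultimately have "(\<lambda>n. (1 / norm x) ^ n + C * (real n * (1 / norm x) ^ n)) \<longlonglongrightarrow> 0 + C * 0"
      by (rule tendsto_add[OF _ tendsto_mult_left])
    then show ?thesis by (simp add: add_divide_distrib power_divide mult.commute)
  qed
  ultimately have "(\<lambda>m. (1 + real (2^m) * C) / norm x ^ (2^m)) \<longlonglongrightarrow> 0"
    by (rule filterlim_compose[rotated])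
  then have "eventually (\<lambda>m. (1 + real (2^m) * C) / norm x ^ (2^m) < 1) sequentially"
    by (rule order_tendstoD) simp
  then obtain m where "(1 + real (2^m) * C) / norm x ^ (2^m) < 1"
    by (auto simp: eventually_sequentially)
  moreover have "norm x ^ (2^m) > 0" using r by (intro zero_less_power) linarith
  ultimately have "1 + real (2^m) * C < norm x ^ (2^m)"
    by (simp add: divide_less_eq)
  with assms(2)[of "2^m"] norm_power_selfadjoint[OF assms(1), of m] show False by simp
qed


section \<open>Positivity of squares and of states\<close>

lemma adj_mult_eq_zero_iff: "adj x * x = 0 \<longleftrightarrow> x = (0::'b::unital_cstar_algebra)"
  using cstar_identity[of x] by auto

text \<open>
  Kaplansky's argument. Put \<open>u = - c\<^sup>* c\<close> and \<open>v = c c\<^sup>*\<close>. As \<open>v - u = c c\<^sup>* + c\<^sup>* c\<close> is a sum of squares of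
  selfadjoint elements, \<open>v\<close> is positive, hence \<open>\<parallel>1 - v\<parallel> \<le> 1\<close>. The relation \<open>(1 - v) c = c (1 + u)\<close> turns this into a uniform bound for
  \<open>u (1 + u)\<^sup>n\<close>, the difference of consecutive powers of \<open>1 + u\<close>. These powers therefore grow at most
  linearly, which forces \<open>\<parallel>1 + u\<parallel> \<le> 1\<close> and makes \<open>- u\<close> positive too. So \<open>u = 0\<close>.
\<close>

lemma adj_mult_self_neg_square:
  fixes c :: "'b::unital_cstar_algebra"
  assumes c: "norm c \<le> 1" and w: "adj w = w" and cw: "adj c * c = - (w * w)"
  shows "c = 0"
proof -
  define u where "u = w * w"
  define v where "v = c * adj c"
  have u: "adj c * c = - u" using cw by (simp add: u_def)
  have u_sa: "adj u = u" by (simp add: u_def adj_mult w)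
  \<comment> \<open>With real and imaginary parts \<open>a\<close> and \<open>b\<close> (up to a factor) one has \<open>a\<^sup>2 + b\<^sup>2 = 2 (c c\<^sup>* + c\<^sup>* c)\<close>.\<close>
  define a where "a = c + adj c"
  define b where "b = \<i> *\<^sub>C (c - adj c)"
  have sa: "adj a = a" "adj b = b"
    by (simp_all add: a_def b_def adj_add adj_adj adj_scaleC adj_diff
        complex_vector.scale_minus_left complex_vector.scale_right_diff_distrib add.commute)
  have "b * b = - ((c - adj c) * (c - adj c))"
    by (simp add: b_def mult_scaleC_left mult_scaleC_right scaleC_scaleC
        complex_vector.scale_minus_left scaleC_one)
  then have "a * a + b * b = 2 *\<^sub>R (v + adj c * c)"
    by (simp add: a_def v_def algebra_simps scaleR_2)
  then have "v = (1/2) *\<^sub>R (a * a + b * b) + u"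
    by (simp add: u)
  moreover have "a * a \<in> positive_elements" "b * b \<in> positive_elements" "u \<in> positive_elements"
    using sa w by (auto simp: positive_elements_def u_def)
  ultimately have "v \<in> positive_elements"
    by (simp add: positive_elements_add positive_elements_scaleR)
  moreover have "norm v \<le> 1"
    unfolding v_def using norm_mult_ineq[of c "adj c"] c mult_le_one[of "norm c" "norm c"] by simp
  ultimately have v1: "norm (1 - v) \<le> 1"
    by (rule positive_elements_norm_le(1))
  have intertwine: "(1 - v) ^ n * c = c * (1 + u) ^ n" for n
  proof (induction n)
    case (Suc n)
    have "v * c = - (c * u)" by (simp add: v_def mult.assoc u)
    then have "(1 - v) * c = c * (1 + u)" by (simp add: algebra_simps)
    then show ?case using Suc by (simp add: mult.assoc) (simp add: mult.assoc[symmetric])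
  qed simp
  have bound: "norm (u * (1 + u) ^ n) \<le> 1" for n
  proof -
    have "u * (1 + u) ^ n = - (adj c * ((1 - v) ^ n * c))"
      by (simp add: intertwine mult.assoc[symmetric] u)
    also have "norm \<dots> \<le> norm c * (norm ((1 - v) ^ n) * norm c)"
      using norm_mult_ineq[of "adj c" "(1 - v) ^ n * c"] 
        mult_left_mono[OF norm_mult_ineq[of "(1 - v) ^ n" c], of "norm c"] by simp
    also have "norm ((1 - v) ^ n) \<le> 1"
      using norm_power_ineq[of "1 - v" n] v1 power_le_one[of "norm (1 - v)" n] by simp
    then have "norm c * (norm ((1 - v) ^ n) * norm c) \<le> 1"
      using c by (intro mult_le_one mult_nonneg_nonneg) auto
    finally show ?thesis .
  qed
  have "norm ((1 + u) ^ n) \<le> 1 + real n * 1" for n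
  proof (induction n)
    case (Suc n)
    have "(1 + u) ^ Suc n = (1 + u) ^ n + u * (1 + u) ^ n" by (simp add: algebra_simps)
    then show ?case
      using norm_triangle_ineq[of "(1 + u) ^ n" "u * (1 + u) ^ n"] Suc bound[of n] by simp
  qed simp
  then have "norm (1 - - u) \<le> 1"
    using norm_power_linear_growth_imp[of "1 + u" 1] u_sa by (simp add: adj_add)
  moreover have "adj (- u) = - u" by (simp add: adj_minus u_sa)
  ultimately obtain y where y: "adj y = y" "y * y = - u"
    and com: "\<And>z. z * (- u) = (- u) * z \<Longrightarrow> z * y = y * z"
    using square_root_commuting[of "- u"] by metis
  have wy: "w * y = y * w" by (rule com) (simp add: u_def mult.assoc)
  have "adj (w + \<i> *\<^sub>C y) * (w + \<i> *\<^sub>C y) = 0"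
    using adj_mult_commuting_pair[OF w y(1) wy] y(2) by (simp add: u_def)
  then have 0: "w + \<i> *\<^sub>C y = 0" by (simp add: adj_mult_eq_zero_iff)
  have "adj (w + \<i> *\<^sub>C y) = w - \<i> *\<^sub>C y"
    by (simp add: adj_add adj_scaleC w y complex_vector.scale_minus_left)
  then have "(w + \<i> *\<^sub>C y) + (w - \<i> *\<^sub>C y) = 0" using 0 by (metis add_0 adj_zero)
  then have "2 *\<^sub>R w = 0" by (simp add: scaleR_2)
  then have "w = 0" by simp
  then show ?thesis using cw by (simp add: adj_mult_eq_zero_iff)
qed

text \<open>
  Let \<open>h = b\<^sup>* b\<close>, let \<open>k\<close> be the square root of \<open>h\<^sup>2\<close>, to be thought of as \<open>|h|\<close>, and let \<open>q = k - h\<close>, which is twice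
  the negative part of \<open>h\<close>. Since \<open>h q = - k q\<close>, the element \<open>c = b q\<close> satisfies
  \<open>c\<^sup>* c = q h q = - (k\<^sup>1\<^sup>/\<^sup>2 q)\<^sup>2\<close>. So \<open>c = 0\<close>, whence \<open>q = 0\<close> and \<open>h = k\<close>.
\<close>

lemma adj_mult_self_positive_unit_ball:
  fixes b :: "'b::unital_cstar_algebra"
  assumes b: "norm b \<le> 1"
  shows "adj b * b \<in> positive_elements"
proof -
  define h where "h = adj b * b"
  have h: "adj h = h" by (simp add: h_def adj_mult adj_adj)
  have "norm h \<le> 1" using b by (simp add: h_def cstar_identity power_le_one)
  then have "norm (1 - h * h) \<le> 1" by (rule norm_one_minus_square_le(1)[OF h])
  moreover have "adj (h * h) = h * h" by (simp add: adj_mult h)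
  ultimately obtain k where k: "adj k = k" "k * k = h * h" "norm (1 - k) \<le> 1"
    and kcom: "\<And>z. z * (h * h) = (h * h) * z \<Longrightarrow> z * k = k * z"
    using square_root_commuting[of "h * h"] by metis
  have hk: "h * k = k * h" by (rule kcom) (simp add: mult.assoc)
  obtain m where m: "adj m = m" "m * m = k"
    and mcom: "\<And>z. z * k = k * z \<Longrightarrow> z * m = m * z"
    using square_root_commuting[OF k(1,3)] by metis
  define q where "q = k - h"
  have q: "adj q = q" by (simp add: q_def adj_diff k h)
  have "q * k = k * q" by (simp add: q_def algebra_simps hk)
  then have qm: "q * m = m * q" by (rule mcom)
  have hq: "h * q = - (k * q)" by (simp add: q_def algebra_simps k hk)
  \<comment> \<open>Scaling into the unit ball, where the previous lemma applies.\<close>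
  define s where "s = 1 / (1 + norm (b * q))"
  have s: "s > 0" by (simp add: s_def add_pos_nonneg)
  define c where "c = s *\<^sub>R (b * q)"
  have "c = 0"
  proof (rule adj_mult_self_neg_square)
    show "norm c \<le> 1" by (simp add: c_def s_def divide_le_eq add_pos_nonneg)
    show "adj (s *\<^sub>R (m * q)) = s *\<^sub>R (m * q)" by (simp add: adj_scaleR adj_mult m q qm)
    have "adj (b * q) * (b * q) = q * (h * q)"
      by (simp add: h_def adj_mult q mult.assoc)
    also have "\<dots> = - ((q * m) * (m * q))" by (simp add: hq m(2)[symmetric] mult.assoc)
    finally have "adj (b * q) * (b * q) = - ((m * q) * (m * q))" by (simp add: qm)
    then show "adj c * c = - (s *\<^sub>R (m * q) * s *\<^sub>R (m * q))"
      by (simp add: c_def adj_scaleR)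
  qed
  then have "b * q = 0" using s by (simp add: c_def)
  then have "h * q = 0" by (simp add: h_def mult.assoc)
  moreover from this have "k * q = 0" using hq by simp
  ultimately have "adj q * q = 0" by (simp add: q) (simp add: q_def algebra_simps)
  then have "h = m * m" by (simp add: adj_mult_eq_zero_iff) (simp add: q_def m)
  then show ?thesis
    unfolding positive_elements_def h_def[symmetric] using m(1) by blast
qed

text \<open>
  Functionals on subspaces are always extended to the whole algebra, so that a single
  function space, with its product topology, carries all compactness arguments.
\<close>

definition dual_ball :: "('b::unital_cstar_algebra \<Rightarrow> complex) set" where
  "dual_ball = {f. (\<forall>x y. f (x + y) = f x + f y) \<and> (\<forall>c x. f (c *\<^sub>C x) = c * f x) \<and>
     (\<forall>x. cmod (f x) \<le> norm x)}"

lemma dual_ballD: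
  assumes "f \<in> dual_ball"
  shows "f (x + y) = f x + f y" "f (c *\<^sub>C x) = c * f x" "cmod (f x) \<le> norm x"
    "f 0 = 0" "f (- x) = - f x" "f (x - y) = f x - f y" "f (r *\<^sub>R x) = complex_of_real r * f x"
proof -
  show *: "f (x + y) = f x + f y" "f (c *\<^sub>C x) = c * f x" "cmod (f x) \<le> norm x" for x y c
    using assms by (auto simp: dual_ball_def)
  show "f (r *\<^sub>R x) = complex_of_real r * f x" by (simp add: scaleR_eq_scaleC *)
  show 0: "f 0 = 0" using *(3)[of 0] by simp
  show m: "f (- x) = - f x" for x using *(1)[of x "- x"] by (simp add: 0 eq_neg_iff_add_eq_0 add.commute)
  show "f (x - y) = f x - f y" using *(1)[of x "- y"] by (simp add: m)
qed

lemma states_UNIV: "states UNIV = {f \<in> dual_ball. f 1 = 1}"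
  by (auto simp: states_def dual_ball_def)

text \<open>
  Compare \<open>\<psi> (h + it)\<close> with \<open>\<parallel>h + it\<parallel>\<^sup>2 \<le> \<parallel>h\<parallel>\<^sup>2 + t\<^sup>2\<close>: a non-zero imaginary part of \<open>\<psi> h\<close> adds a term linear in
  \<open>t\<close> on the left.
\<close>

lemma state_selfadjoint_real:
  assumes \<psi>: "\<psi> \<in> states UNIV" and h: "adj h = h"
  shows "Im (\<psi> h) = 0"
proof (rule ccontr)
  define \<beta> where "\<beta> = Im (\<psi> h)"
  assume "Im (\<psi> h) \<noteq> 0"
  then have \<beta>: "\<beta> \<noteq> 0" by (simp add: \<beta>_def)
  have db: "\<psi> \<in> dual_ball" "\<psi> 1 = 1" using \<psi> by (auto simp: states_UNIV)
  \<comment> \<open>Solves \<open>2 \<beta> t = \<parallel>h\<parallel>\<^sup>2 + 1\<close>, one more than \<open>\<beta>\<^sup>2 + 2 \<beta> t \<le> \<parallel>h\<parallel>\<^sup>2\<close> permits.\<close>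
  define t where "t = ((norm h)\<^sup>2 + 1) / (2 * \<beta>)"
  define x where "x = h + \<i> *\<^sub>C (t *\<^sub>R 1)"
  have "\<psi> x = \<psi> h + \<i> * complex_of_real t" by (simp add: x_def dual_ballD[OF db(1)] db)
  then have "(\<beta> + t)\<^sup>2 \<le> (cmod (\<psi> x))\<^sup>2" by (simp add: cmod_def \<beta>_def)
  also have "\<dots> \<le> (norm x)\<^sup>2" by (intro power_mono dual_ballD[OF db(1)]) auto
  also have "\<dots> = norm (h * h + (t *\<^sub>R 1) * (t *\<^sub>R 1))"
    using adj_mult_commuting_pair[of h "t *\<^sub>R 1"] h cstar_identity[of x]
    by (simp add: x_def adj_scaleR)
  also have "\<dots> \<le> (norm h)\<^sup>2 + t\<^sup>2"
    using norm_triangle_ineq[of "h * h" "(t *\<^sub>R 1) * (t *\<^sub>R 1)"] norm_square_selfadjoint[OF h]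
    by (simp add: power2_eq_square abs_mult)
  finally have "\<beta>\<^sup>2 + 2 * \<beta> * t \<le> (norm h)\<^sup>2" by (simp add: power2_eq_square algebra_simps)
  moreover have "2 * \<beta> * t = (norm h)\<^sup>2 + 1" using \<beta> by (simp add: t_def)
  ultimately show False using zero_le_power2[of \<beta>] by linarith
qed

lemma state_adj:
  assumes \<psi>: "\<psi> \<in> states UNIV"
  shows "\<psi> (adj y) = cnj (\<psi> y)"
proof -
  have db: "\<psi> \<in> dual_ball" using \<psi> by (auto simp: states_UNIV)
  have "Im (\<psi> (y + adj y)) = 0"
    by (rule state_selfadjoint_real[OF \<psi>]) (simp add: adj_add adj_adj add.commute)
  moreover have "Im (\<psi> (\<i> *\<^sub>C (y - adj y))) = 0"
    by (rule state_selfadjoint_real[OF \<psi>])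
      (simp add: adj_scaleC adj_diff adj_adj complex_vector.scale_minus_left
        complex_vector.scale_right_diff_distrib)
  ultimately show ?thesis by (simp add: dual_ballD[OF db] complex_eq_iff)
qed

text \<open>
  After scaling, positivity of \<open>b\<^sup>* b\<close> gives \<open>\<parallel>1 - b\<^sup>* b\<parallel> \<le> 1\<close>; so \<open>|1 - \<psi> (b\<^sup>* b)| \<le> 1\<close>.
\<close>

lemma state_positive:
  assumes \<psi>: "\<psi> \<in> states UNIV"
  shows "0 \<le> Re (\<psi> (adj b * b))" and "Im (\<psi> (adj b * b)) = 0"
proof -
  have db: "\<psi> \<in> dual_ball" "\<psi> 1 = 1" using \<psi> by (auto simp: states_UNIV)
  show "Im (\<psi> (adj b * b)) = 0"
    by (rule state_selfadjoint_real[OF \<psi>]) (simp add: adj_mult adj_adj)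
  define s where "s = 1 / (1 + norm b)"
  have s: "s > 0" by (simp add: s_def add_pos_nonneg)
  define c where "c = s *\<^sub>R b"
  have c: "norm c \<le> 1" by (simp add: c_def s_def divide_le_eq add_pos_nonneg)
  then have "norm (adj c * c) \<le> 1" by (simp add: cstar_identity power_le_one)
  then have "norm (1 - adj c * c) \<le> 1"
    using positive_elements_norm_le(1) adj_mult_self_positive_unit_ball[OF c] by blast
  then have "cmod (1 - \<psi> (adj c * c)) \<le> 1"
    using dual_ballD(3)[OF db(1), of "1 - adj c * c"] by (simp add: dual_ballD(6)[OF db(1)] db)
  then have "0 \<le> Re (\<psi> (adj c * c))"
    using complex_Re_le_cmod[of "1 - \<psi> (adj c * c)"] by simp
  also have "adj c * c = (s * s) *\<^sub>R (adj b * b)" by (simp add: c_def adj_scaleR)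
  finally show "0 \<le> Re (\<psi> (adj b * b))"
    using mult_pos_pos[OF s s] by (simp add: dual_ballD(7)[OF db(1)] zero_le_mult_iff)
qed

text \<open>
  The case of the Cauchy-Schwarz inequality in which one factor vanishes: \<open>\<psi> ((x + z c)\<^sup>* (x + z c))\<close> is then
  real affine in \<open>z\<close> and nonnegative, so its linear part must vanish.
\<close>

lemma state_null_left:
  assumes \<psi>: "\<psi> \<in> states UNIV" and c: "Re (\<psi> (adj c * c)) \<le> 0"
  shows "\<psi> (adj c * x) = 0"
proof (rule ccontr)
  assume n: "\<psi> (adj c * x) \<noteq> 0"
  define p where "p = \<psi> (adj c * x)"
  have db: "\<psi> \<in> dual_ball" using \<psi> by (auto simp: states_UNIV)
  have pp: "p * cnj p = complex_of_real ((cmod p)\<^sup>2)" "cnj p * p = complex_of_real ((cmod p)\<^sup>2)"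
    by (simp_all only: complex_norm_square mult.commute)
  have p': "\<psi> (adj x * c) = cnj p"
    using state_adj[OF \<psi>, of "adj c * x"] by (simp add: p_def adj_mult adj_adj)
  \<comment> \<open>With \<open>z = - t p\<close> both cross terms equal \<open>- t |p|\<^sup>2\<close>; this \<open>t\<close> makes the sum at most \<open>- 1\<close>.\<close>
  define t where "t = (Re (\<psi> (adj x * x)) + 1) / (2 * (cmod p)\<^sup>2)"
  define z where "z = - (complex_of_real t * p)"
  let ?y = "x + z *\<^sub>C c"
  have "\<psi> (adj ?y * ?y) = \<psi> (adj x * x) + z * cnj p + cnj z * p + cnj z * z * \<psi> (adj c * c)"
    by (simp add: adj_add adj_scaleC algebra_simps mult_scaleC_left mult_scaleC_right
        scaleC_scaleC dual_ballD[OF db] p' p_def)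
  also have "z * cnj p = - complex_of_real (t * (cmod p)\<^sup>2)"
    by (simp add: z_def mult.assoc pp)
  also have "cnj z * p = - complex_of_real (t * (cmod p)\<^sup>2)"
    by (simp add: z_def mult.assoc pp)
  also have "cnj z * z = complex_of_real ((cmod z)\<^sup>2)"
    by (simp only: complex_norm_square mult.commute)
  finally have "Re (\<psi> (adj ?y * ?y)) =
      Re (\<psi> (adj x * x)) - 2 * t * (cmod p)\<^sup>2 + (cmod z)\<^sup>2 * Re (\<psi> (adj c * c))"
    by simp
  also have "2 * t * (cmod p)\<^sup>2 = Re (\<psi> (adj x * x)) + 1"
    using n by (simp add: t_def p_def)
  finally show False
    using state_positive(1)[OF \<psi>, of ?y] c mult_nonneg_nonpos[OF zero_le_power2[of "cmod z"] c]
    by linarith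
qed


section \<open>Extension of functionals\<close>

definition sublinear :: "('a::real_vector \<Rightarrow> real) \<Rightarrow> bool" where
  "sublinear p \<longleftrightarrow> (\<forall>x y. p (x + y) \<le> p x + p y) \<and> (\<forall>t\<ge>0. \<forall>x. p (t *\<^sub>R x) = t * p x)"

lemma sublinearD:
  assumes "sublinear p"
  shows "p (x + y) \<le> p x + p y" "0 \<le> t \<Longrightarrow> p (t *\<^sub>R x) = t * p x" "p 0 = 0" "- p (- x) \<le> p x"
proof -
  show *: "p (x + y) \<le> p x + p y" "0 \<le> t \<Longrightarrow> p (t *\<^sub>R x) = t * p x" for x y t
    using assms by (auto simp: sublinear_def)
  show 0: "p 0 = 0" using *(2)[of 0 0] by simp
  show "- p (- x) \<le> p x" using *(1)[of x "- x"] 0 by simp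
qed

lemma sublinearI:
  assumes add: "\<And>x y. p (x + y) \<le> p x + p y" and zero: "p 0 = 0"
    and scale: "\<And>t x. 0 < t \<Longrightarrow> p (t *\<^sub>R x) \<le> t * p x"
  shows "sublinear p"
  unfolding sublinear_def
proof (intro conjI allI impI)
  fix t :: real and x assume "0 \<le> t"
  show "p (t *\<^sub>R x) = t * p x"
  proof (cases "t = 0")
    case False
    then have t: "t > 0" using \<open>0 \<le> t\<close> by simp
    have "p (inverse t *\<^sub>R t *\<^sub>R x) \<le> inverse t * p (t *\<^sub>R x)" using t by (intro scale) simp
    then have "t * p x \<le> p (t *\<^sub>R x)" using t by (simp add: field_simps)
    then show ?thesis using scale[OF t, of x] by simp
  qed (simp add: zero)
qed (rule add)

text \<open>
  Both the extension of a functional from a subspace and the linearity of minimal sublinear functionals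
  need a partial infimum of a jointly sublinear function over a convex cone.
\<close>

lemma sublinear_INF_over_cone:
  fixes F :: "'a::real_vector \<Rightarrow> 'i::real_vector \<Rightarrow> real"
  assumes T: "0 \<in> T" "\<And>s t. s \<in> T \<Longrightarrow> t \<in> T \<Longrightarrow> s + t \<in> T" "\<And>r t. 0 < r \<Longrightarrow> t \<in> T \<Longrightarrow> r *\<^sub>R t \<in> T"
    and add: "\<And>x y s t. s \<in> T \<Longrightarrow> t \<in> T \<Longrightarrow> F (x + y) (s + t) \<le> F x s + F y t"
    and scale: "\<And>r x t. 0 < r \<Longrightarrow> t \<in> T \<Longrightarrow> F (r *\<^sub>R x) (r *\<^sub>R t) = r * F x t"
    and below: "\<And>x t. t \<in> T \<Longrightarrow> l x \<le> F x t" and zero: "F 0 0 = 0" "l 0 = 0"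
  shows "sublinear (\<lambda>x. INF t\<in>T. F x t)" "t \<in> T \<Longrightarrow> (INF t\<in>T. F x t) \<le> F x t"
proof -
  let ?q = "\<lambda>x. INF t\<in>T. F x t"
  have bdd: "bdd_below (F x ` T)" for x using below by (auto simp: bdd_below_def)
  show lower: "t \<in> T \<Longrightarrow> ?q x \<le> F x t" for x t by (rule cINF_lower[OF bdd])
  have ne: "T \<noteq> {}" using T(1) by auto
  show "sublinear ?q"
  proof (rule sublinearI)
    fix x y
    have "?q (x + y) - ?q x \<le> F y t" if t: "t \<in> T" for t
    proof -
      have "?q (x + y) - F y t \<le> ?q x"
      proof (rule cINF_greatest[OF ne])
        fix s assume s: "s \<in> T"
        show "?q (x + y) - F y t \<le> F x s"
          using lower[OF T(2)[OF s t], of "x + y"] add[OF s t, of x y] by linarith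
      qed
      then show ?thesis by linarith
    qed
    then have "?q (x + y) - ?q x \<le> ?q y" by (rule cINF_greatest[OF ne])
    then show "?q (x + y) \<le> ?q x + ?q y" by linarith
  next
    have "0 \<le> ?q 0" by (rule cINF_greatest[OF ne]) (use below[where x = 0] zero in simp)
    then show "?q 0 = 0" using lower[OF T(1), of 0] zero(1) by linarith
  next
    fix r :: real and x assume r: "0 < r"
    have "?q (r *\<^sub>R x) / r \<le> ?q x"
    proof (rule cINF_greatest[OF ne])
      fix t assume t: "t \<in> T"
      show "?q (r *\<^sub>R x) / r \<le> F x t"
        using lower[OF T(3)[OF r t], of "r *\<^sub>R x"] scale[OF r t, of x] r by (simp add: field_simps)
    qed
    then show "?q (r *\<^sub>R x) \<le> r * ?q x" using r by (simp add: field_simps)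
  qed
qed

text \<open>
  Zorn's lemma applies because all sublinear \<open>q \<le> p\<close> share the lower bound \<open>q x \<ge> - p (- x)\<close>, so infima
  of chains exist.
\<close>

lemma minimal_sublinear_below:
  fixes p :: "'a::real_vector \<Rightarrow> real"
  assumes p: "sublinear p"
  obtains m where "sublinear m" "\<And>x. m x \<le> p x"
    "\<And>q. sublinear q \<Longrightarrow> (\<And>x. q x \<le> m x) \<Longrightarrow> q = m"
proof -
  define A where "A = {q. sublinear q \<and> (\<forall>x. q x \<le> p x)}"
  define P :: "('a \<Rightarrow> real) \<Rightarrow> ('a \<Rightarrow> real) \<Rightarrow> bool" where "P = (\<lambda>q r. \<forall>x. r x \<le> q x)"
  have "\<exists>m\<in>A. \<forall>a\<in>A. P m a \<longrightarrow> a = m"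
  proof (rule predicate_Zorn)
    show "partial_order_on A (relation_of P A)"
      unfolding partial_order_on_def preorder_on_def
      by (auto simp: relation_of_def P_def refl_on_def trans_def antisym_def intro: order_trans
          intro!: ext order_antisym)
  next
    fix C assume C: "C \<in> Chains (relation_of P A)"
    then have CA: "C \<subseteq> A" and tot: "\<And>q r. q \<in> C \<Longrightarrow> r \<in> C \<Longrightarrow> P q r \<or> P r q"
      by (auto simp: Chains_def relation_of_def)
    show "\<exists>u\<in>A. \<forall>a\<in>C. P a u"
    proof (cases "C = {}")
      case True
      then show ?thesis using p by (auto simp: A_def)
    next
      case ne: False
      let ?u = "\<lambda>x. INF q\<in>C. q x"
      have sub: "sublinear q" "q x \<le> p x" if "q \<in> C" for q x using that CA by (auto simp: A_def)
      have below: "- p (- x) \<le> q x" if "q \<in> C" for q x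
        using sublinearD(4)[OF sub(1)[OF that], of x] sub(2)[OF that, of "- x"] by linarith
      have bdd: "bdd_below ((\<lambda>q. q x) ` C)" for x using below by (auto simp: bdd_below_def)
      have lower: "?u x \<le> q x" if "q \<in> C" for q x by (rule cINF_lower[OF bdd that])
      have "sublinear ?u"
      proof (rule sublinearI)
        fix x y
        have "?u (x + y) - ?u x \<le> r y" if r: "r \<in> C" for r
        proof -
          have "?u (x + y) - r y \<le> ?u x"
          proof (rule cINF_greatest[OF ne])
            fix q assume q: "q \<in> C"
            \<comment> \<open>Subadditivity at the smaller of two comparable members of the chain.\<close>
            from tot[OF q r] show "?u (x + y) - r y \<le> q x"
            proof
              assume "P q r"
              then show ?thesis using lower[OF r, of "x + y"] sublinearD(1)[OF sub(1)[OF r], of x y]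
                unfolding P_def by (smt (verit))
            next
              assume "P r q"
              then show ?thesis using lower[OF q, of "x + y"] sublinearD(1)[OF sub(1)[OF q], of x y]
                unfolding P_def by (smt (verit))
            qed
          qed
          then show ?thesis by linarith
        qed
        then have "?u (x + y) - ?u x \<le> ?u y" by (rule cINF_greatest[OF ne])
        then show "?u (x + y) \<le> ?u x + ?u y" by linarith
      next
        have "(\<lambda>q. q 0) ` C = {0}" using ne sublinearD(3)[OF sub(1)] by (auto simp: image_iff)
        then show "?u 0 = 0" by simp
      next
        fix t :: real and x assume t: "0 < t"
        have "?u (t *\<^sub>R x) / t \<le> ?u x"
        proof (rule cINF_greatest[OF ne])
          fix q assume q: "q \<in> C"
          show "?u (t *\<^sub>R x) / t \<le> q x"
            using lower[OF q, of "t *\<^sub>R x"] sublinearD(2)[OF sub(1)[OF q], of t x] t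
            by (simp add: field_simps)
        qed
        then show "?u (t *\<^sub>R x) \<le> t * ?u x" using t by (simp add: field_simps)
      qed
      moreover have "?u x \<le> p x" for x
        using ne lower sub(2) by (meson ex_in_conv order_trans)
      ultimately show ?thesis using lower by (intro bexI[of _ ?u]) (auto simp: A_def P_def)
    qed
  qed
  then obtain m where m: "m \<in> A" "\<And>q. q \<in> A \<Longrightarrow> P m q \<Longrightarrow> q = m" by blast
  show ?thesis
  proof (rule that[of m])
    fix q assume "sublinear q" "\<And>x. q x \<le> m x"
    then show "q = m" using m by (intro m(2)) (auto simp: A_def P_def intro: order_trans)
  qed (use m(1) in \<open>auto simp: A_def\<close>)
qed

text \<open>
  For fixed \<open>y\<close> the functional \<open>x \<mapsto> INF t \<ge> 0. m (x + t y) - t m y\<close> is sublinear and below \<open>m\<close>, hence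
  equal to \<open>m\<close>. Its value at \<open>t = 1\<close> gives \<open>m x + m y \<le> m (x + y)\<close>.
\<close>

lemma minimal_sublinear_is_linear:
  fixes m :: "'a::real_vector \<Rightarrow> real"
  assumes m: "sublinear m" and min: "\<And>q. sublinear q \<Longrightarrow> (\<And>x. q x \<le> m x) \<Longrightarrow> q = m"
  shows "linear m"
proof -
  have "m x + m y \<le> m (x + y)" for x y
  proof -
    let ?F = "\<lambda>x t. m (x + t *\<^sub>R y) - t * m y"
    let ?q = "\<lambda>x. INF t\<in>{0..}. ?F x t"
    have q: "sublinear ?q" "t \<in> {0..} \<Longrightarrow> ?q x \<le> ?F x t" for x t
    proof (atomize(full), intro conjI impI allI)
      have add: "?F (x1 + x2) (s + t) \<le> ?F x1 s + ?F x2 t" for x1 x2 s t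
        using sublinearD(1)[OF m, of "x1 + s *\<^sub>R y" "x2 + t *\<^sub>R y"] by (simp add: algebra_simps)
      have scale: "?F (r *\<^sub>R x) (r *\<^sub>R t) = r * ?F x t" if "0 < r" for r x t
        using sublinearD(2)[OF m, of r "x + t *\<^sub>R y"] that by (simp add: algebra_simps)
      have below: "- m (- x) \<le> ?F x t" if "t \<in> {0..}" for x t
        using sublinearD(1)[OF m, of "x + t *\<^sub>R y" "- x"] sublinearD(2)[OF m, of t y] that by simp
      note * = sublinear_INF_over_cone[of "{0..}" ?F "\<lambda>x. - m (- x)", OF _ _ _ add scale below]
      show "sublinear ?q" by (rule *(1)) (auto simp: sublinearD(3)[OF m])
      show "?q x \<le> ?F x t" if "t \<in> {0..}" for x t
        by (rule *(2)) (use that in \<open>auto simp: sublinearD(3)[OF m]\<close>)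
    qed
    have "?q x \<le> m x" for x
    proof -
      have "?q x \<le> ?F x 0" by (rule q(2)) simp
      then show ?thesis by simp
    qed
    then have "?q = m" by (rule min[OF q(1)])
    then have "?q x = m x" by (rule fun_cong)
    moreover have "?q x \<le> ?F x 1" by (rule q(2)) simp
    ultimately have "m x \<le> ?F x 1" by linarith
    then show ?thesis by simp
  qed
  then have add: "m (x + y) = m x + m y" for x y
    using sublinearD(1)[OF m, of x y] by (simp add: order_antisym)
  have neg: "m (- x) = - m x" for x
    using add[of x "- x"] sublinearD(3)[OF m] by simp
  show ?thesis
  proof (rule linearI[OF add])
    fix r x
    show "m (r *\<^sub>R x) = r *\<^sub>R m x"
    proof (cases "0 \<le> r")
      case False
      then show ?thesis using sublinearD(2)[OF m, of "- r" x] neg[of "r *\<^sub>R x"] by simp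
    qed (simp add: sublinearD(2)[OF m])
  qed
qed

text \<open>
  The real part is a minimal sublinear functional below \<open>x \<mapsto> INF m \<in> M. \<parallel>x - m\<parallel> + Re (\<phi> m)\<close>, which is at most
  the norm everywhere and at most \<open>Re \<phi>\<close> on \<open>M\<close>. The complex functional is recovered as \<open>F x - i F (ix)\<close>.
\<close>

theorem hahn_banach_dual_ball:
  fixes \<phi> :: "'b::unital_cstar_algebra \<Rightarrow> complex"
  assumes M: "complex_vector.subspace M"
    and add: "\<And>x y. x \<in> M \<Longrightarrow> y \<in> M \<Longrightarrow> \<phi> (x + y) = \<phi> x + \<phi> y"
    and scale: "\<And>c x. x \<in> M \<Longrightarrow> \<phi> (c *\<^sub>C x) = c * \<phi> x"
    and bound: "\<And>x. x \<in> M \<Longrightarrow> cmod (\<phi> x) \<le> norm x"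
  obtains \<psi> where "\<psi> \<in> dual_ball" "\<And>x. x \<in> M \<Longrightarrow> \<psi> x = \<phi> x"
proof -
  note sub = complex_vector.subspace_0[OF M] complex_vector.subspace_add[OF M]
    complex_vector.subspace_scale[OF M] 
  have zero: "\<phi> 0 = 0" using bound[OF sub(1)] by simp
  have MR: "r *\<^sub>R x \<in> M" "\<phi> (r *\<^sub>R x) = complex_of_real r * \<phi> x" if "x \<in> M" for r x
    using that sub(3) scale by (simp_all add: scaleR_eq_scaleC)
  let ?F = "\<lambda>x m. norm (x - m) + Re (\<phi> m)"
  let ?p = "\<lambda>x. INF m\<in>M. ?F x m"
  have addF: "?F (x + y) (s + t) \<le> ?F x s + ?F y t" if "s \<in> M" "t \<in> M" for x y s t
    using norm_triangle_ineq[of "x - s" "y - t"] add[OF that] by (simp add: algebra_simps)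
  have scaleF: "?F (r *\<^sub>R x) (r *\<^sub>R t) = r * ?F x t" if "0 < r" "t \<in> M" for r x t
    using that by (simp add: MR algebra_simps scaleR_diff_right[symmetric] del: scaleR_diff_right)
  have below: "- norm x \<le> ?F x t" if "t \<in> M" for x t
    using norm_triangle_ineq3[of x t] bound[OF that] abs_Re_le_cmod[of "\<phi> t"] by linarith
  note * = sublinear_INF_over_cone[of M ?F "\<lambda>x. - norm x", OF sub(1,2) MR(1) addF scaleF below]
  have p: "sublinear ?p" by (rule *(1)) (auto simp: zero)
  have lower: "?p x \<le> ?F x m" if "m \<in> M" for x m by (rule *(2)) (use that in \<open>auto simp: zero\<close>)
  obtain F where F: "sublinear F" "\<And>x. F x \<le> ?p x"
    "\<And>q. sublinear q \<Longrightarrow> (\<And>x. q x \<le> F x) \<Longrightarrow> q = F"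
    using minimal_sublinear_below[OF p] by blast
  have lin: "linear F" using minimal_sublinear_is_linear F(1,3) by blast
  have Fnorm: "F x \<le> norm x" for x using F(2)[of x] lower[OF sub(1), of x] zero by simp
  have FM: "F m = Re (\<phi> m)" if m: "m \<in> M" for m
  proof -
    have le: "F y \<le> Re (\<phi> y)" if "y \<in> M" for y using F(2)[of y] lower[OF that, of y] by simp
    have "- m \<in> M" "\<phi> (- m) = - \<phi> m" using MR[OF m, of "- 1"] by simp_all
    then show ?thesis using le[OF m] le[of "- m"] linear_neg[OF lin, of m] by simp
  qed
  define \<psi> where "\<psi> x = Complex (F x) (- F (\<i> *\<^sub>C x))" for x
  have FC: "F (c *\<^sub>C x) = Re c * F x + Im c * F (\<i> *\<^sub>C x)" for c x
  proof -
    have "c *\<^sub>C x = Re c *\<^sub>R x + Im c *\<^sub>R (\<i> *\<^sub>C x)"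
      by (simp add: scaleR_eq_scaleC scaleC_scaleC scaleC_add_left[symmetric]
          complex_eq[symmetric] mult.commute)
    then show ?thesis by (simp add: linear_add[OF lin] linear_scale[OF lin])
  qed
  have \<psi>add: "\<psi> (x + y) = \<psi> x + \<psi> y" for x y
    by (simp add: \<psi>_def scaleC_add_right linear_add[OF lin] complex_eq_iff)
  have \<psi>scale: "\<psi> (c *\<^sub>C x) = c * \<psi> x" for c x
    using FC[of c x] FC[of "\<i> * c" x] by (simp add: \<psi>_def scaleC_scaleC complex_eq_iff algebra_simps)
  have \<psi>bound: "cmod (\<psi> x) \<le> norm x" for x
  proof (cases "\<psi> x = 0")
    case False
    have pp: "\<psi> x * cnj (\<psi> x) = complex_of_real (cmod (\<psi> x)) * complex_of_real (cmod (\<psi> x))"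
      using complex_norm_square[of "\<psi> x"] by (simp add: power2_eq_square)
    define c where "c = cnj (\<psi> x) / complex_of_real (cmod (\<psi> x))"
    have c: "c * \<psi> x = complex_of_real (cmod (\<psi> x))" "cmod c = 1"
      using False pp by (simp_all add: c_def norm_divide mult.commute)
    have "cmod (\<psi> x) = Re (\<psi> (c *\<^sub>C x))" by (simp add: \<psi>scale c)
    also have "\<dots> \<le> norm (c *\<^sub>C x)" using Fnorm by (simp add: \<psi>_def)
    finally show ?thesis by (simp add: norm_scaleC c)
  qed simp
  show ?thesis
  proof
    show "\<psi> \<in> dual_ball" by (simp add: dual_ball_def \<psi>add \<psi>scale \<psi>bound)
    show "\<psi> x = \<phi> x" if "x \<in> M" for x
      using that by (simp add: \<psi>_def FM sub(3) scale complex_eq_iff)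
  qed
qed

lemma state_extension_exists:
  assumes "unital_subspace M" "\<phi> \<in> states M"
  obtains \<psi> where "\<psi> \<in> states UNIV" "\<And>x. x \<in> M \<Longrightarrow> \<psi> x = \<phi> x"
proof -
  have M: "complex_vector.subspace M" "1 \<in> M" using assms by (auto simp: unital_subspace_def)
  obtain \<psi> where "\<psi> \<in> dual_ball" "\<And>x. x \<in> M \<Longrightarrow> \<psi> x = \<phi> x"
    by (rule hahn_banach_dual_ball[OF M(1), of \<phi>]) (use assms in \<open>auto simp: states_def\<close>)
  moreover from this have "\<psi> 1 = 1" using M(2) assms(2) by (simp add: states_def)
  ultimately show ?thesis using that[of \<psi>] by (simp add: states_UNIV)
qed

text \<open>
  A contractive functional with value \<open>1\<close> at \<open>h = b\<^sup>* b\<close>, extended from the line through \<open>h\<close>, is automatically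
  unital: \<open>\<parallel>1 - 2 h\<parallel> \<le> 1\<close> gives \<open>|\<psi> 1 - 2| \<le> 1\<close>, and the only point of the closed unit disc within
  distance \<open>1\<close> of \<open>2\<close> is \<open>1\<close>.
\<close>

lemma norming_state_exists:
  fixes b :: "'b::unital_cstar_algebra"
  assumes b: "norm b = 1"
  obtains \<psi> where "\<psi> \<in> states UNIV" "\<psi> (adj b * b) = 1"
proof -
  define h where "h = adj b * b"
  have nh: "norm h = 1" using b by (simp add: h_def cstar_identity)
  then have h0: "h \<noteq> 0" by auto
  have "h \<in> positive_elements" unfolding h_def using b by (intro adj_mult_self_positive_unit_ball) simp
  then have n2: "norm (1 - 2 *\<^sub>R h) \<le> 1" using nh by (intro positive_elements_norm_le(2)) simp_all
  \<comment> \<open>Only its values \<open>\<phi> (c h) = c\<close> on the line through \<open>h\<close> matter.\<close>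
  define \<phi> where "\<phi> x = (THE c. x = c *\<^sub>C h)" for x
  have \<phi>: "\<phi> (c *\<^sub>C h) = c" for c
    unfolding \<phi>_def using h0 by (intro the_equality) (auto simp: complex_vector.scale_cancel_right)
  have span: "complex_vector.subspace (range (\<lambda>c. c *\<^sub>C h))"
    unfolding complex_vector.subspace_def
    by (auto simp: scaleC_add_left[symmetric] scaleC_scaleC intro: range_eqI[of _ _ 0])
  obtain \<psi> where \<psi>: "\<psi> \<in> dual_ball" "\<And>x. x \<in> range (\<lambda>c. c *\<^sub>C h) \<Longrightarrow> \<psi> x = \<phi> x"
    by (rule hahn_banach_dual_ball[OF span, of \<phi>])
      (auto simp: \<phi> scaleC_add_left[symmetric] scaleC_scaleC norm_scaleC nh)
  have "h \<in> range (\<lambda>c. c *\<^sub>C h)" by (metis rangeI scaleC_one)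
  then have \<psi>h: "\<psi> h = 1" using \<psi>(2) \<phi>[of 1] by (simp add: scaleC_one)
  have "cmod (\<psi> 1 - 2) \<le> 1"
    using dual_ballD(3)[OF \<psi>(1), of "1 - 2 *\<^sub>R h"] n2 \<psi>h
    by (simp add: dual_ballD(6,7)[OF \<psi>(1)])
  moreover have "cmod (\<psi> 1) \<le> 1" using dual_ballD(3)[OF \<psi>(1), of 1] by simp
  ultimately have "Re (\<psi> 1) = 1"
    using complex_Re_le_cmod[of "\<psi> 1"] abs_Re_le_cmod[of "\<psi> 1 - 2"] by simp
  moreover from this have "Im (\<psi> 1) = 0"
    using \<open>cmod (\<psi> 1) \<le> 1\<close> by (auto simp: cmod_def)
  ultimately show ?thesis using \<psi>(1) \<psi>h by (intro that[of \<psi>]) (auto simp: states_UNIV h_def complex_eq_iff)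
qed


section \<open>Exposing functionals by elements of a subspace\<close>

lemma continuous_on_evaluation [continuous_intros]:
  "continuous_on S (\<lambda>f. f x :: 'c::topological_space)"
  by (rule continuous_on_subset[OF continuous_on_product_coordinates]) simp

lemma dual_ball_bounded_linear: "f \<in> dual_ball \<Longrightarrow> bounded_linear f"
  by (rule bounded_linear_intro[where K = 1], simp_all only: dual_ballD scaleR_conv_of_real[where 'a = complex])
    (simp_all add: dual_ballD(3))

lemma compact_dual_ball: "compact (dual_ball :: ('b::unital_cstar_algebra \<Rightarrow> complex) set)"
proof -
  let ?P = "PiE UNIV (\<lambda>x::'b. cball (0::complex) (norm x))"
  have "compactin (product_topology (\<lambda>_. euclidean) UNIV) ?P"
    by (simp add: compactin_PiE)
  then have "compact ?P" by (simp add: euclidean_product_topology)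
  moreover have "closed ({f. \<forall>x y. f (x + y) = f x + f y} \<inter>
      {f. \<forall>c x. f (c *\<^sub>C x) = c * f x} :: ('b \<Rightarrow> complex) set)"
    by (intro closed_Int closed_Collect_all closed_Collect_eq continuous_intros)
  ultimately have "compact (?P \<inter> ({f. \<forall>x y. f (x + y) = f x + f y} \<inter> {f. \<forall>c x. f (c *\<^sub>C x) = c * f x}))"
    by (rule compact_Int_closed)
  also have "?P \<inter> ({f. \<forall>x y. f (x + y) = f x + f y} \<inter> {f. \<forall>c x. f (c *\<^sub>C x) = c * f x}) = dual_ball"
    by (auto simp: dual_ball_def PiE_def)
  finally show ?thesis .
qed

lemma compact_subset_dual_ball:
  "closed S \<Longrightarrow> compact (dual_ball \<inter> S)"
  by (rule compact_Int_closed[OF compact_dual_ball])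

lemma compact_states: "compact (states UNIV :: ('b::unital_cstar_algebra \<Rightarrow> complex) set)"
proof -
  have "states UNIV = dual_ball \<inter> {f :: 'b \<Rightarrow> complex. f 1 = 1}" by (auto simp: states_UNIV)
  then show ?thesis
    by (simp add: compact_subset_dual_ball closed_Collect_eq continuous_on_evaluation)
qed

text \<open>
  A countable dense subset of the algebra need not meet \<open>M\<close>. For each of its points and each \<open>n\<close>, pick a point
  of \<open>M\<close> within \<open>1 / (n + 1)\<close>, if there is one; the chosen points are dense in \<open>M\<close> and are then scaled
  into the unit ball.
\<close>

lemma separating_sequence_exists:
  fixes M :: "'b::unital_cstar_algebra set"
  assumes sep: "separable_space (euclidean :: 'b topology)" and M: "complex_vector.subspace M"
  obtains d where "\<And>n::nat. d n \<in> M" "\<And>n. norm (d n) \<le> 1"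
    "\<And>f g x. f \<in> dual_ball \<Longrightarrow> g \<in> dual_ball \<Longrightarrow> (\<And>n. f (d n) = g (d n)) \<Longrightarrow> x \<in> M \<Longrightarrow> f x = g x"
proof -
  obtain C :: "'b set" where C: "countable C" "closure C = UNIV"
    using sep by (auto simp: separable_space_def)
  define I where "I = {(c, n). c \<in> C \<and> (\<exists>m\<in>M. dist m c < 1 / real (Suc n))}"
  define pick where "pick = (\<lambda>(c, n). SOME m. m \<in> M \<and> dist m c < 1 / real (Suc n))"
  have pick: "pick (c, n) \<in> M \<and> dist (pick (c, n)) c < 1 / real (Suc n)" if "(c, n) \<in> I" for c n
    using that unfolding I_def pick_def by simp (rule someI_ex, auto)
  have "countable I" by (rule countable_subset[of _ "C \<times> UNIV"]) (auto simp: I_def C)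
  define S where "S = insert 0 (pick ` I)"
  have S: "countable S" "S \<noteq> {}" "S \<subseteq> M"
    using \<open>countable I\<close> pick complex_vector.subspace_0[OF M] by (auto simp: S_def)
  have dense: "\<exists>s\<in>S. dist s x < e" if x: "x \<in> M" and e: "e > 0" for x e
  proof -
    obtain n where n: "1 / real (Suc n) < e / 2"
      using nat_approx_posE[of "e / 2"] e by auto
    have "x \<in> closure C" using C by simp
    then obtain c where c: "c \<in> C" "dist c x < 1 / real (Suc n)"
      using closure_approachable[of x C] by (metis of_nat_0_less_iff zero_less_Suc zero_less_divide_1_iff)
    then have "(c, n) \<in> I" using x by (auto simp: I_def dist_commute)
    then have "pick (c, n) \<in> S" "dist (pick (c, n)) c < 1 / real (Suc n)"
      using pick by (auto simp: S_def)
    moreover have "dist (pick (c, n)) x < e"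
      using dist_triangle[of "pick (c, n)" x c] c(2) n \<open>dist (pick (c, n)) c < _\<close> by linarith
    ultimately show ?thesis by blast
  qed
  define e where "e = from_nat_into S"
  have range_e: "range e = S" unfolding e_def using S by (simp add: range_from_nat_into)
  define d where "d n = (1 / (1 + norm (e n))) *\<^sub>R e n" for n
  have pos: "1 + norm (e n) > 0" for n by (simp add: add_pos_nonneg)
  show ?thesis
  proof (rule that[of d])
    fix n
    have "e n \<in> M" using range_e S by auto
    then show "d n \<in> M" by (simp add: d_def scaleR_eq_scaleC complex_vector.subspace_scale[OF M])
    show "norm (d n) \<le> 1" using pos[of n] by (simp add: d_def divide_le_eq)
  next
    fix f g :: "'b \<Rightarrow> complex" and x
    assume fg: "f \<in> dual_ball" "g \<in> dual_ball" and eq: "\<And>n. f (d n) = g (d n)" and x: "x \<in> M"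
    have eqS: "f s = g s" if "s \<in> S" for s
    proof -
      obtain n where "s = e n" using \<open>s \<in> S\<close> range_e by auto
      then have "s = (1 + norm (e n)) *\<^sub>R d n" using pos[of n] by (simp add: d_def)
      then show ?thesis using eq[of n] by (simp add: dual_ballD(7)[OF fg(1)] dual_ballD(7)[OF fg(2)])
    qed
    have "cmod (f x - g x) \<le> 0 + e" if "e > 0" for e
    proof -
      obtain s where s: "s \<in> S" "dist s x < e / 2" using dense[OF x half_gt_zero[OF \<open>e > 0\<close>]] by auto
      have "f x - g x = f (x - s) - g (x - s)"
        by (simp add: dual_ballD(6)[OF fg(1)] dual_ballD(6)[OF fg(2)] eqS[OF s(1)])
      also have "cmod \<dots> \<le> norm (x - s) + norm (x - s)"
        using norm_triangle_ineq4[of "f (x - s)" "g (x - s)"]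
          dual_ballD(3)[OF fg(1), of "x - s"] dual_ballD(3)[OF fg(2), of "x - s"] by linarith
      finally show ?thesis using s(2) by (simp add: dist_norm norm_minus_commute)
    qed
    then have "cmod (f x - g x) \<le> 0" by (rule field_le_epsilon)
    then show "f x = g x" by simp
  qed
qed

text \<open>
  The square of a Hilbert seminorm of \<open>f - g\<close>, a norm on functionals that the sequence \<open>d\<close> separates. It is
  continuous for the weak-\<open>*\<close> topology on
  bounded sets.
\<close>

definition sqdist :: "(nat \<Rightarrow> 'b::unital_cstar_algebra) \<Rightarrow> ('b \<Rightarrow> complex) \<Rightarrow> ('b \<Rightarrow> complex) \<Rightarrow> real" where
  "sqdist d f g = (\<Sum>n. (1/2) ^ n * (cmod (f (d n) - g (d n)))\<^sup>2)"

text \<open>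
  Half the derivative of \<open>f \<mapsto> sqdist d f g\<close>. It is evaluation at an element of the algebra, and this
  element lies in every closed subspace containing the sequence \<open>d\<close>.
\<close>

definition gradient :: "(nat \<Rightarrow> 'b::unital_cstar_algebra) \<Rightarrow> ('b \<Rightarrow> complex) \<Rightarrow> ('b \<Rightarrow> complex) \<Rightarrow> 'b" where
  "gradient d f g = (\<Sum>n. (1/2) ^ n *\<^sub>R (cnj (f (d n) - g (d n)) *\<^sub>C d n))"

lemma summable_half_power: "summable (\<lambda>n. (1/2) ^ n * c :: real)"
  by (intro summable_mult2 summable_geometric) simp

lemma sums_half_power: "(\<lambda>n. (1/2) ^ n * c :: real) sums (2 * c)"
  using sums_mult2[OF geometric_sums[of "1/2::real"], of c] by simp

context
  fixes d :: "nat \<Rightarrow> 'b::unital_cstar_algebra"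
  assumes d: "\<And>n. norm (d n) \<le> 1"
begin

lemma dual_ball_diff_le:
  assumes "f \<in> dual_ball" "g \<in> dual_ball"
  shows "cmod (f (d n) - g (d n)) \<le> 2"
  using norm_triangle_ineq4[of "f (d n)" "g (d n)"] dual_ballD(3)[OF assms(1), of "d n"]
    dual_ballD(3)[OF assms(2), of "d n"] d[of n] by linarith

lemma sqdist_term_le:
  assumes "f \<in> dual_ball" "g \<in> dual_ball"
  shows "norm ((1/2) ^ n * (cmod (f (d n) - g (d n)))\<^sup>2) \<le> (1/2) ^ n * 4"
  using power_mono[OF dual_ball_diff_le[OF assms, of n], of 2]
  by (simp add: abs_mult mult_left_mono)

lemma sqdist_sums:
  assumes "f \<in> dual_ball" "g \<in> dual_ball"
  shows "(\<lambda>n. (1/2) ^ n * (cmod (f (d n) - g (d n)))\<^sup>2) sums sqdist d f g"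
  unfolding sqdist_def
  by (intro summable_sums summable_comparison_test'[OF summable_half_power[of 4], of 0])
    (use sqdist_term_le[OF assms] in blast)

lemma sqdist_nonneg: "f \<in> dual_ball \<Longrightarrow> g \<in> dual_ball \<Longrightarrow> 0 \<le> sqdist d f g"
  using sums_le[OF _ sums_zero sqdist_sums] by auto

lemma sqdist_eq_0D:
  assumes "f \<in> dual_ball" "g \<in> dual_ball" "sqdist d f g = 0"
  shows "f (d n) = g (d n)"
  using suminf_eq_zero_iff[OF sums_summable[OF sqdist_sums[OF assms(1,2)]]] assms(3)
  by (simp add: sqdist_def)

lemma continuous_on_sqdist:
  assumes "g \<in> dual_ball"
  shows "continuous_on dual_ball (\<lambda>f. sqdist d f g)"
  unfolding sqdist_def
proof (rule uniform_limit_theorem[OF _ Weierstrass_m_test])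
  show "summable (\<lambda>n. (1/2) ^ n * 4 :: real)" by (rule summable_half_power)
  show "\<forall>\<^sub>F n in sequentially. continuous_on dual_ball (\<lambda>f. \<Sum>i<n. (1/2) ^ i * (cmod (f (d i) - g (d i)))\<^sup>2)"
    by (intro always_eventually allI continuous_intros)
qed (use sqdist_term_le assms in auto)

lemma gradient_sums:
  assumes "f \<in> dual_ball" "g \<in> dual_ball"
  shows "(\<lambda>n. (1/2) ^ n *\<^sub>R (cnj (f (d n) - g (d n)) *\<^sub>C d n)) sums gradient d f g"
    and "norm (gradient d f g) \<le> 4"
proof -
  have *: "norm ((1/2) ^ n *\<^sub>R (cnj (f (d n) - g (d n)) *\<^sub>C d n)) \<le> (1/2) ^ n * 2" for n
  proof -
    have "cmod (f (d n) - g (d n)) * norm (d n) \<le> 2 * 1"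
      by (intro mult_mono dual_ball_diff_le[OF assms] d) auto
    then show ?thesis by (simp add: norm_scaleC complex_mod_cnj del: complex_cnj_diff)
  qed
  then show "(\<lambda>n. (1/2) ^ n *\<^sub>R (cnj (f (d n) - g (d n)) *\<^sub>C d n)) sums gradient d f g"
    unfolding gradient_def
    by (intro summable_sums summable_comparison_test'[OF summable_half_power[of 2], of 0])
  show "norm (gradient d f g) \<le> 4"
    unfolding gradient_def using norm_suminf_le[OF * summable_half_power]
      sums_unique[OF sums_half_power[of 2]] by simp
qed

lemma gradient_mem:
  assumes "f \<in> dual_ball" "g \<in> dual_ball"
    and M: "complex_vector.subspace M" "closed M" "\<And>n. d n \<in> M"
  shows "gradient d f g \<in> M"
proof (rule closed_sequentially[OF M(2)])
  show "(\<lambda>N. \<Sum>n<N. (1/2) ^ n *\<^sub>R (cnj (f (d n) - g (d n)) *\<^sub>C d n)) \<longlonglongrightarrow> gradient d f g"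
    using gradient_sums(1)[OF assms(1,2)] by (simp add: sums_def)
  show "(\<Sum>n<N. (1/2) ^ n *\<^sub>R (cnj (f (d n) - g (d n)) *\<^sub>C d n)) \<in> M" for N
    by (intro complex_vector.subspace_sum[OF M(1)])
      (simp add: scaleR_eq_scaleC complex_vector.subspace_scale[OF M(1)] M(3))
qed

text \<open>
  Second order expansion of \<open>f \<mapsto> sqdist d f z\<close> at \<open>g\<close>. Its remainder is \<open>sqdist d f g\<close>, and this exact
  remainder is what makes maximisers strict and nearest points separating.
\<close>

lemma sqdist_expand:
  assumes f: "f \<in> dual_ball" and g: "g \<in> dual_ball" and z: "z \<in> dual_ball"
  shows "sqdist d f z = sqdist d g z + 2 * Re (f (gradient d g z) - g (gradient d g z)) + sqdist d f g"
proof -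
  have polarisation: "w * (cmod (b - c))\<^sup>2
      + 2 * (Re (complex_of_real w * (cnj (b - c) * a)) - Re (complex_of_real w * (cnj (b - c) * b)))
      + w * (cmod (a - b))\<^sup>2 = w * (cmod (a - c))\<^sup>2" for w a b c
    by (simp add: cmod_power2) (simp add: power2_eq_square algebra_simps)
  let ?t = "\<lambda>n. (1/2) ^ n *\<^sub>R (cnj (g (d n) - z (d n)) *\<^sub>C d n)"
  have app: "(\<lambda>n. Re (h (?t n))) sums Re (h (gradient d g z))" if "h \<in> dual_ball" for h
    by (intro bounded_linear.sums[OF bounded_linear_Re]
        bounded_linear.sums[OF dual_ball_bounded_linear[OF that]] gradient_sums g z)
  have "(\<lambda>n. (1/2) ^ n * (cmod (g (d n) - z (d n)))\<^sup>2 + 2 * (Re (f (?t n)) - Re (g (?t n)))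
      + (1/2) ^ n * (cmod (f (d n) - g (d n)))\<^sup>2) sums
      (sqdist d g z + 2 * (Re (f (gradient d g z)) - Re (g (gradient d g z))) + sqdist d f g)"
    by (intro sums_add sums_mult sums_diff app sqdist_sums f g z)
  moreover have "(1/2) ^ n * (cmod (g (d n) - z (d n)))\<^sup>2 + 2 * (Re (f (?t n)) - Re (g (?t n)))
      + (1/2) ^ n * (cmod (f (d n) - g (d n)))\<^sup>2 = (1/2) ^ n * (cmod (f (d n) - z (d n)))\<^sup>2" for n
    unfolding dual_ballD(2,7)[OF f] dual_ballD(2,7)[OF g] by (rule polarisation)
  ultimately have "(\<lambda>n. (1/2) ^ n * (cmod (f (d n) - z (d n)))\<^sup>2) sums
      (sqdist d g z + 2 * (Re (f (gradient d g z)) - Re (g (gradient d g z))) + sqdist d f g)"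
    by simp
  from sums_unique2[OF sqdist_sums[OF f z] this] show ?thesis by simp
qed

end

lemma zero_in_dual_ball: "(\<lambda>_. 0) \<in> dual_ball"
  by (simp add: dual_ball_def)

text \<open>
  Maximise \<open>Re (f x0) + \<delta> * sqdist d f 0\<close> over \<open>K\<close>. By the expansion at a maximiser \<open>g\<close>, the perturbed element
  \<open>x = x0 + 2 \<delta> r\<close>, with \<open>r\<close> the gradient at \<open>g\<close>, satisfies \<open>Re (f x) + \<delta> * sqdist d f g \<le> Re (g x)\<close>
  for every \<open>f\<close> in \<open>K\<close>.
\<close>

theorem exposing_element_near:
  fixes M :: "'b::unital_cstar_algebra set"
  assumes sep: "separable_space (euclidean :: 'b topology)"
    and M: "complex_vector.subspace M" "closed M"
    and K: "K \<subseteq> dual_ball" "compact K" "K \<noteq> {}" and x0: "x0 \<in> M" and \<epsilon>: "0 < \<epsilon>"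
  obtains x g where "x \<in> M" "norm (x - x0) \<le> \<epsilon>" "g \<in> K" "\<And>f. f \<in> K \<Longrightarrow> Re (f x) \<le> Re (g x)"
    "\<And>f y. f \<in> K \<Longrightarrow> Re (f x) = Re (g x) \<Longrightarrow> y \<in> M \<Longrightarrow> f y = g y"
proof -
  obtain d where d: "\<And>n::nat. d n \<in> M" "\<And>n. norm (d n) \<le> 1"
    "\<And>f g x. f \<in> dual_ball \<Longrightarrow> g \<in> dual_ball \<Longrightarrow> (\<And>n. f (d n) = g (d n)) \<Longrightarrow> x \<in> M \<Longrightarrow> f x = g x"
    using separating_sequence_exists[OF sep M(1)] by metis
  \<comment> \<open>The perturbation is \<open>2 \<delta>\<close> times a gradient, whose norm is at most \<open>4\<close>.\<close>
  define \<delta> where "\<delta> = \<epsilon> / 8"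
  have \<delta>: "\<delta> > 0" using \<epsilon> by (simp add: \<delta>_def)
  note Z = zero_in_dual_ball
  have "continuous_on K (\<lambda>f. Re (f x0) + \<delta> * sqdist d f (\<lambda>_. 0))"
    by (intro continuous_intros continuous_on_subset[OF continuous_on_sqdist[where d = d, OF d(2) Z] K(1)])
  then obtain g where g: "g \<in> K"
    "\<And>f. f \<in> K \<Longrightarrow> Re (f x0) + \<delta> * sqdist d f (\<lambda>_. 0) \<le> Re (g x0) + \<delta> * sqdist d g (\<lambda>_. 0)"
    using continuous_attains_sup[OF K(2,3)] by blast
  have gb: "g \<in> dual_ball" using g K by blast
  define r where "r = gradient d g (\<lambda>_. 0)"
  define x where "x = x0 + (2 * \<delta>) *\<^sub>R r"
  have main: "Re (f x) + \<delta> * sqdist d f g \<le> Re (g x)" if f: "f \<in> K" for f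
  proof -
    have fb: "f \<in> dual_ball" using f K by blast
    have "\<delta> * sqdist d f (\<lambda>_. 0) = \<delta> * sqdist d g (\<lambda>_. 0) + 2 * \<delta> * (Re (f r) - Re (g r)) + \<delta> * sqdist d f g"
      by (simp add: sqdist_expand[where d = d, OF d(2) fb gb Z] r_def algebra_simps)
    moreover have "Re (f x) = Re (f x0) + 2 * \<delta> * Re (f r)" "Re (g x) = Re (g x0) + 2 * \<delta> * Re (g r)"
      by (simp_all add: x_def dual_ballD(1,7)[OF fb] dual_ballD(1,7)[OF gb])
    ultimately show ?thesis using g(2)[OF f] by (simp add: algebra_simps)
  qed
  show ?thesis
  proof (rule that[of x g])
    have "r \<in> M" unfolding r_def by (rule gradient_mem[where d = d, OF d(2) gb Z M d(1)])
    then show "x \<in> M"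
      by (simp add: x_def x0 scaleR_eq_scaleC complex_vector.subspace_add[OF M(1)]
          complex_vector.subspace_scale[OF M(1)])
    have "norm r \<le> 4" unfolding r_def by (rule gradient_sums(2)[where d = d, OF d(2) gb Z])
    then show "norm (x - x0) \<le> \<epsilon>" using \<epsilon> by (simp add: x_def \<delta>_def)
    fix f assume f: "f \<in> K"
    then have fb: "f \<in> dual_ball" using K by blast
    have nn: "0 \<le> \<delta> * sqdist d f g" using sqdist_nonneg[where d = d, OF d(2) fb gb] \<delta> by simp
    then show "Re (f x) \<le> Re (g x)" using main[OF f] by linarith
    fix y assume eq: "Re (f x) = Re (g x)" and y: "y \<in> M"
    have "sqdist d f g = 0" using main[OF f] nn eq \<delta> by auto
    then show "f y = g y" by (intro d(3)[OF fb gb _ y] sqdist_eq_0D[where d = d, OF d(2) fb gb])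
  qed (rule g)
qed

text \<open>
  The predicate \<open>convex\<close> is tied to the class of real vector spaces, to which function types do not belong.
\<close>

definition convex_functionals :: "('b \<Rightarrow> complex) set \<Rightarrow> bool" where
  "convex_functionals D \<longleftrightarrow> (\<forall>f\<in>D. \<forall>g\<in>D. \<forall>t\<in>{0..1::real}.
     (\<lambda>x. complex_of_real t * f x + complex_of_real (1 - t) * g x) \<in> D)"

lemma quadratic_perturbation_nonneg:
  fixes a b :: real
  assumes "\<And>t. 0 < t \<Longrightarrow> t \<le> 1 \<Longrightarrow> 0 \<le> t * a + t\<^sup>2 * b" "0 \<le> b"
  shows "0 \<le> a"
proof (rule ccontr)
  assume a: "\<not> 0 \<le> a"
  define t where "t = min 1 (- a / (2 * (b + 1)))"
  have t: "0 < t" "t \<le> 1" using a assms(2) by (auto simp: t_def intro!: divide_neg_pos)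
  have "t \<le> - a / (2 * (b + 1))" by (simp add: t_def)
  then have "t * (2 * (b + 1)) \<le> - a" using assms(2) by (subst (asm) pos_le_divide_eq) auto
  then have "t * b < - a" using t assms(2) a by (simp add: algebra_simps)
  then have "t * (a + t * b) < 0" using t by (intro mult_pos_neg) auto
  then show False using assms(1)[OF t] by (simp add: power2_eq_square algebra_simps)
qed

text \<open>
  The point \<open>g\<close> of \<open>D\<close> nearest to \<open>\<phi>\<close> for \<open>sqdist\<close> exists by compactness. The first order condition at \<open>g\<close>
  says that the negative of the gradient, an element of \<open>M\<close>, attains its maximum over \<open>D\<close> at \<open>g\<close>, while
  its value at \<open>\<phi>\<close> is larger by the squared distance.
\<close>

theorem strict_separation:
  fixes M :: "'b::unital_cstar_algebra set"
  assumes sep: "separable_space (euclidean :: 'b topology)"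
    and M: "complex_vector.subspace M" "closed M"
    and D: "D \<subseteq> dual_ball" "compact D" "convex_functionals D"
    and \<phi>: "\<phi> \<in> dual_ball" and differ: "\<And>f. f \<in> D \<Longrightarrow> \<exists>y\<in>M. f y \<noteq> \<phi> y"
  obtains x \<eta> where "x \<in> M" "0 < \<eta>" "\<And>f. f \<in> D \<Longrightarrow> Re (f x) + \<eta> \<le> Re (\<phi> x)"
proof (cases "D = {}")
  case True
  then show ?thesis using that[of 0 1] complex_vector.subspace_0[OF M(1)] by auto
next
  case ne: False
  obtain d where d: "\<And>n::nat. d n \<in> M" "\<And>n. norm (d n) \<le> 1"
    "\<And>f g x. f \<in> dual_ball \<Longrightarrow> g \<in> dual_ball \<Longrightarrow> (\<And>n. f (d n) = g (d n)) \<Longrightarrow> x \<in> M \<Longrightarrow> f x = g x"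
    using separating_sequence_exists[OF sep M(1)] by metis
  have "continuous_on D (\<lambda>f. sqdist d f \<phi>)"
    by (rule continuous_on_subset[OF continuous_on_sqdist[where d = d, OF d(2) \<phi>] D(1)])
  then obtain g where g: "g \<in> D" "\<And>f. f \<in> D \<Longrightarrow> sqdist d g \<phi> \<le> sqdist d f \<phi>"
    using continuous_attains_inf[OF D(2) ne] by blast
  have gb: "g \<in> dual_ball" using g D by blast
  define r where "r = gradient d g \<phi>"
  have pos: "0 < sqdist d g \<phi>"
  proof -
    have "sqdist d g \<phi> \<noteq> 0"
    proof
      assume "sqdist d g \<phi> = 0"
      then have "g (d n) = \<phi> (d n)" for n by (rule sqdist_eq_0D[where d = d, OF d(2) gb \<phi>])
      then show False using differ[OF g(1)] d(3)[OF gb \<phi>] by blast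
    qed
    then show ?thesis using sqdist_nonneg[where d = d, OF d(2) gb \<phi>] by simp
  qed
  have sup: "Re (g r) \<le> Re (f r)" if f: "f \<in> D" for f
  proof -
    have fb: "f \<in> dual_ball" using f D by blast
    have "0 \<le> t * (2 * (Re (f r) - Re (g r))) + t\<^sup>2 * sqdist d f g" if t: "0 < t" "t \<le> 1" for t
    proof -
      define h where "h = (\<lambda>x. complex_of_real t * f x + complex_of_real (1 - t) * g x)"
      have h: "h \<in> D" using D(3) f g(1) t by (auto simp: convex_functionals_def h_def)
      then have hb: "h \<in> dual_ball" using D by blast
      have "h x - g x = complex_of_real t * (f x - g x)" for x by (simp add: h_def algebra_simps)
      then have "sqdist d h g = (\<Sum>n. t\<^sup>2 * ((1/2) ^ n * (cmod (f (d n) - g (d n)))\<^sup>2))"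
        unfolding sqdist_def by (simp add: norm_mult power_mult_distrib mult.left_commute)
      also have "\<dots> = t\<^sup>2 * sqdist d f g"
        unfolding sqdist_def by (rule suminf_mult[OF sums_summable[OF sqdist_sums[where d = d, OF d(2) fb gb]]])
      finally have "sqdist d h g = t\<^sup>2 * sqdist d f g" .
      then show ?thesis
        using g(2)[OF h] sqdist_expand[where d = d, OF d(2) hb gb \<phi>] by (simp add: h_def r_def algebra_simps)
    qed
    from quadratic_perturbation_nonneg[OF this sqdist_nonneg[where d = d, OF d(2) fb gb]] show ?thesis by simp
  qed
  have self: "sqdist d \<phi> \<phi> = 0" by (simp add: sqdist_def)
  have "0 = sqdist d g \<phi> + 2 * (Re (\<phi> r) - Re (g r)) + sqdist d \<phi> g"
    using sqdist_expand[where d = d, OF d(2) \<phi> gb \<phi>] by (simp add: self r_def)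
  moreover have "sqdist d \<phi> g = sqdist d g \<phi>" by (simp add: sqdist_def norm_minus_commute)
  ultimately have \<phi>r: "Re (\<phi> r) = Re (g r) - sqdist d g \<phi>" by simp
  show ?thesis
  proof (rule that[of "- r" "sqdist d g \<phi>"])
    have "r \<in> M" unfolding r_def by (rule gradient_mem[where d = d, OF d(2) gb \<phi> M d(1)])
    then show "- r \<in> M" by (rule complex_vector.subspace_neg[OF M(1)])
    fix f assume f: "f \<in> D"
    then have fb: "f \<in> dual_ball" using D by blast
    show "Re (f (- r)) + sqdist d g \<phi> \<le> Re (\<phi> (- r))"
      using sup[OF f] \<phi>r by (simp add: dual_ballD(5)[OF fb] dual_ballD(5)[OF \<phi>])
  qed (rule pos)
qed


section \<open>Pure states and peak sets\<close>

lemma unit_disc_convex_combination_eq_1: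
  assumes t: "0 < t" "t < (1::real)" and a: "cmod a \<le> 1" and b: "cmod b \<le> 1"
    and eq: "complex_of_real t * a + complex_of_real (1 - t) * b = 1"
  shows "a = 1" and "b = 1"
proof -
  have *: "z = 1" if "Re z = 1" "cmod z \<le> 1" for z
    using that by (auto simp: cmod_def complex_eq_iff)
  have R: "Re a \<le> 1" "Re b \<le> 1" using complex_Re_le_cmod[of a] complex_Re_le_cmod[of b] a b by auto
  have "t * Re a + (1 - t) * Re b = 1" using arg_cong[OF eq, of Re] by simp
  then have 0: "t * (1 - Re a) + (1 - t) * (1 - Re b) = 0" by (simp add: algebra_simps)
  have nn: "0 \<le> t * (1 - Re a)" "0 \<le> (1 - t) * (1 - Re b)"
    using t R by (auto intro!: mult_nonneg_nonneg)
  have "t * (1 - Re a) = 0" "(1 - t) * (1 - Re b) = 0" using 0 nn by linarith+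
  then have "Re a = 1" "Re b = 1" using t by auto
  then show "a = 1" "b = 1" using * a b by auto
qed

lemma convex_combination_maximal_eq:
  fixes a b m t :: real
  assumes "0 < t" "t < 1" "a \<le> m" "b \<le> m" "m = t * a + (1 - t) * b"
  shows "a = m" and "b = m"
proof -
  have 0: "t * (m - a) + (1 - t) * (m - b) = 0" using assms(5) by (simp add: algebra_simps)
  have "0 \<le> t * (m - a)" "0 \<le> (1 - t) * (m - b)" using assms by (auto intro!: mult_nonneg_nonneg)
  with 0 have "t * (m - a) = 0" "(1 - t) * (m - b) = 0" by linarith+
  then show "a = m" "b = m" using assms by auto
qed

text \<open>
  States with value \<open>1\<close> at \<open>x\<close> form a compact face, because \<open>1\<close> is an extreme point of the unit disc. A
  functional that is exposed in this face, with the whole algebra as the space of perturbations,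
  is extreme in the face and hence in the state space.
\<close>

lemma pure_state_attaining_bound:
  fixes x :: "'b::unital_cstar_algebra"
  assumes sep: "separable_space (euclidean :: 'b topology)"
    and bound: "\<And>\<psi>. \<psi> \<in> states UNIV \<Longrightarrow> cmod (\<psi> x) \<le> 1"
    and \<psi>0: "\<psi>0 \<in> states UNIV" "\<psi>0 x = 1"
  obtains \<omega> where "\<omega> \<in> pure_states UNIV" "\<omega> x = 1"
proof -
  define E where "E = states UNIV \<inter> {\<psi>. \<psi> x = 1}"
  have E: "E \<subseteq> dual_ball" "compact E" "E \<noteq> {}"
    using \<psi>0 compact_Int_closed[OF compact_states closed_Collect_eq[of "\<lambda>\<psi>. \<psi> x" "\<lambda>_. 1"]]
    by (auto simp: E_def states_UNIV continuous_on_evaluation)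
  obtain z g where g: "g \<in> E" "\<And>f. f \<in> E \<Longrightarrow> Re (f z) \<le> Re (g z)"
    "\<And>f y. f \<in> E \<Longrightarrow> Re (f z) = Re (g z) \<Longrightarrow> f y = g y"
    using exposing_element_near[OF sep complex_vector.subspace_UNIV closed_UNIV E, of 0 1]
    by (metis UNIV_I zero_less_one)
  have "g \<in> pure_states UNIV"
    unfolding pure_states_def
  proof (intro CollectI conjI ballI allI impI)
    show "g \<in> states UNIV" using g(1) by (simp add: E_def)
    fix \<psi>1 \<psi>2 :: "'b \<Rightarrow> complex" and t :: real
    assume \<psi>: "\<psi>1 \<in> states UNIV" "\<psi>2 \<in> states UNIV" and t: "0 < t" "t < 1"
      and "\<forall>x\<in>UNIV. g x = complex_of_real t * \<psi>1 x + complex_of_real (1 - t) * \<psi>2 x"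
    then have eq: "g y = complex_of_real t * \<psi>1 y + complex_of_real (1 - t) * \<psi>2 y" for y by simp
    have "complex_of_real t * \<psi>1 x + complex_of_real (1 - t) * \<psi>2 x = 1"
      using eq[of x] g(1) by (simp add: E_def)
    from unit_disc_convex_combination_eq_1[OF t bound[OF \<psi>(1)] bound[OF \<psi>(2)] this]
    have in_E: "\<psi>1 \<in> E" "\<psi>2 \<in> E" using \<psi> by (auto simp: E_def)
    have "Re (g z) = t * Re (\<psi>1 z) + (1 - t) * Re (\<psi>2 z)" using arg_cong[OF eq[of z], of Re] by simp
    from convex_combination_maximal_eq[OF t g(2)[OF in_E(1)] g(2)[OF in_E(2)] this]
    show "\<psi>1 = g" "\<psi>2 = g" using g(3) in_E by blast+
  qed
  then show ?thesis using g(1) by (intro that[of g]) (auto simp: E_def)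
qed

text \<open>
  Stated for an arbitrary set \<open>X\<close> of candidate peaking elements, because both \<open>X = M\<close> and the squares of
  an algebra are needed.
\<close>

lemma peaking_state_exists:
  fixes M :: "'b::unital_cstar_algebra set"
  assumes sep: "separable_space (euclidean :: 'b topology)" and x: "x \<in> X"
    and g: "g \<in> states UNIV" "g x = 1"
    and bound: "\<And>\<psi>. \<psi> \<in> states UNIV \<Longrightarrow> cmod (\<psi> x) \<le> 1"
    and peak: "\<And>\<psi>. \<psi> \<in> states UNIV \<Longrightarrow> cmod (\<psi> x) = 1 \<Longrightarrow> \<psi> x = 1"
    and unique: "\<And>\<psi> y. \<psi> \<in> states UNIV \<Longrightarrow> \<psi> x = 1 \<Longrightarrow> y \<in> M \<Longrightarrow> \<psi> y = g y"
  obtains \<omega> where "\<omega> \<in> peaking_states X M" "\<omega> x = 1" "\<And>y. y \<in> M \<Longrightarrow> \<omega> y = g y"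
proof -
  obtain \<omega> where \<omega>: "\<omega> \<in> pure_states UNIV" "\<omega> x = 1"
    using pure_state_attaining_bound[OF sep, of x g] bound g by metis
  then have \<omega>s: "\<omega> \<in> states UNIV" by (simp add: pure_states_def)
  define E where "E = {\<psi> \<in> states UNIV. \<psi> x = 1}"
  have "peak_set X E"
    unfolding peak_set_def
  proof (intro conjI bexI[OF _ x] ballI)
    fix \<psi> assume "\<psi> \<in> states UNIV - E"
    then have "\<psi> \<in> states UNIV" "\<psi> x \<noteq> 1" by (auto simp: E_def)
    then show "cmod (\<psi> x) < 1" using bound peak by (metis order_neq_le_trans)
  qed (auto simp: E_def)
  moreover have "E \<subseteq> state_extensions M \<omega>"
  proof
    fix \<psi> assume "\<psi> \<in> E"
    then have "\<psi> \<in> states UNIV" "\<psi> x = 1" by (auto simp: E_def)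
    moreover from this have "restrict \<psi> M = restrict \<omega> M"
      using unique[of \<psi>] unique[OF \<omega>s \<omega>(2)] by (intro restrict_ext) simp
    ultimately show "\<psi> \<in> state_extensions M \<omega>" by (simp add: state_extensions_def)
  qed
  moreover have "E \<noteq> {}" using g by (auto simp: E_def)
  ultimately have "\<omega> \<in> peaking_states X M" using \<omega>(1) by (auto simp: peaking_states_def)
  then show ?thesis using \<omega>(2) unique[OF \<omega>s \<omega>(2)] that by blast
qed

lemma restrict_state:
  assumes "unital_subspace M" "\<psi> \<in> states UNIV"
  shows "restrict \<psi> M \<in> states M"
  using assms complex_vector.subspace_add[of M] complex_vector.subspace_scale[of M]
  by (auto simp: states_def unital_subspace_def)

text \<open>
  If \<open>\<omega>|\<^sub>M\<close> is a proper convex combination of states on \<open>M\<close>, extend these to the algebra. At the peaking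
  element the extensions combine to \<open>1\<close> inside the unit disc, so both equal \<open>1\<close> there. Thus both lie in
  the peak set and agree with \<open>\<omega>\<close> on \<open>M\<close>.
\<close>

lemma restrict_peaking_state_pure:
  assumes M: "unital_subspace M" and \<omega>: "\<omega> \<in> peaking_states M M"
  shows "restrict \<omega> M \<in> pure_states M"
  unfolding pure_states_def
proof (intro CollectI conjI ballI allI impI)
  obtain E where E: "E \<noteq> {}" "peak_set M E" "E \<subseteq> state_extensions M \<omega>"
    using \<omega> by (auto simp: peaking_states_def)
  obtain x where x: "x \<in> M" "\<And>\<psi>. \<psi> \<in> E \<Longrightarrow> \<psi> x = 1"
    "\<And>\<psi>. \<psi> \<in> states UNIV \<Longrightarrow> \<psi> \<notin> E \<Longrightarrow> cmod (\<psi> x) < 1"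
    using E(2) by (auto simp: peak_set_def)
  have ext: "\<psi> y = \<omega> y" if "\<psi> \<in> E" "y \<in> M" for \<psi> y
  proof -
    have "restrict \<psi> M = restrict \<omega> M" using E(3) that(1) by (auto simp: state_extensions_def)
    from fun_cong[OF this, of y] show ?thesis using that(2) by simp
  qed
  have \<omega>x: "\<omega> x = 1" using E(1) ext x by fastforce
  show "restrict \<omega> M \<in> states M"
    using \<omega> by (intro restrict_state M) (simp add: peaking_states_def pure_states_def)
  fix \<phi>1 \<phi>2 :: "'a \<Rightarrow> complex" and t :: real
  assume \<phi>: "\<phi>1 \<in> states M" "\<phi>2 \<in> states M" and t: "0 < t" "t < 1"
    and eq: "\<forall>x\<in>M. restrict \<omega> M x = complex_of_real t * \<phi>1 x + complex_of_real (1 - t) * \<phi>2 x"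
  obtain \<psi>1 where \<psi>1: "\<psi>1 \<in> states UNIV" "\<And>x. x \<in> M \<Longrightarrow> \<psi>1 x = \<phi>1 x"
    using state_extension_exists[OF M \<phi>(1)] by metis
  obtain \<psi>2 where \<psi>2: "\<psi>2 \<in> states UNIV" "\<And>x. x \<in> M \<Longrightarrow> \<psi>2 x = \<phi>2 x"
    using state_extension_exists[OF M \<phi>(2)] by metis
  have bound: "cmod (\<psi> x) \<le> 1" if "\<psi> \<in> states UNIV" for \<psi>
    using x(2)[of \<psi>] x(3)[OF that] by (cases "\<psi> \<in> E") auto
  have "complex_of_real t * \<psi>1 x + complex_of_real (1 - t) * \<psi>2 x = 1"
    using eq x(1) \<omega>x \<psi>1(2) \<psi>2(2) by auto
  from unit_disc_convex_combination_eq_1[OF t bound[OF \<psi>1(1)] bound[OF \<psi>2(1)] this]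
  have in_E: "\<psi>1 \<in> E" "\<psi>2 \<in> E" using x(3)[OF \<psi>1(1)] x(3)[OF \<psi>2(1)] by auto
  have "\<phi>1 y = restrict \<omega> M y" "\<phi>2 y = restrict \<omega> M y" for y
    using ext[OF in_E(1), of y] ext[OF in_E(2), of y] \<psi>1(2)[of y] \<psi>2(2)[of y] \<phi>
    by (auto simp: states_def extensional_def restrict_def)
  then show "\<phi>1 = restrict \<omega> M" "\<phi>2 = restrict \<omega> M" by auto
qed

lemma unimodular_rotation:
  obtains \<mu> where "cmod \<mu> = 1" "\<mu> * z = complex_of_real (cmod z)"
proof (cases "z = 0")
  case True
  then show ?thesis using that[of 1] by simp
next
  case False
  have "z * cnj z = complex_of_real (cmod z) * complex_of_real (cmod z)"
    using complex_norm_square[of z] by (simp add: power2_eq_square)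
  then show ?thesis using False
    by (intro that[of "cnj z / complex_of_real (cmod z)"]) (simp_all add: norm_divide mult.commute)
qed

text \<open>
  Expose a functional in the compact set of unimodular multiples of states. The unit turns equality up to
  a phase into equality, since states take the value \<open>1\<close> at it.
\<close>

lemma modulus_peaking_near:
  fixes M :: "'b::unital_cstar_algebra set"
  assumes sep: "separable_space (euclidean :: 'b topology)"
    and M: "unital_subspace M" "closed M" and x0: "x0 \<in> M" and \<epsilon>: "0 < \<epsilon>"
    and ne: "states (UNIV :: 'b set) \<noteq> {}"
  obtains x g where "x \<in> M" "norm (x - x0) \<le> \<epsilon>" "g \<in> states UNIV"
    "\<And>\<psi>. \<psi> \<in> states UNIV \<Longrightarrow> cmod (\<psi> x) \<le> cmod (g x)"
    "\<And>\<psi> y. \<psi> \<in> states UNIV \<Longrightarrow> cmod (\<psi> x) = cmod (g x) \<Longrightarrow> y \<in> M \<Longrightarrow> \<psi> y = g y"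
proof -
  have M': "complex_vector.subspace M" "1 \<in> M" using M by (auto simp: unital_subspace_def)
  define rot where "rot = (\<lambda>(\<mu> :: complex, \<psi> :: 'b \<Rightarrow> complex) x. \<mu> * \<psi> x)"
  define K where "K = rot ` (sphere 0 1 \<times> states UNIV)"
  have "continuous_on (sphere 0 1 \<times> states UNIV) rot"
    unfolding rot_def case_prod_beta
  proof (rule continuous_on_coordinatewise_then_product)
    fix x :: 'b
    let ?S = "sphere (0::complex) 1 \<times> states (UNIV :: 'b set)"
    have "continuous_on ?S (\<lambda>p. snd p x)"
      by (rule continuous_on_product_then_coordinatewise, intro continuous_intros)
    then show "continuous_on ?S (\<lambda>p. fst p * snd p x)" by (intro continuous_intros)
  qed
  then have Kc: "compact K"
    unfolding K_def by (intro compact_continuous_image compact_Times compact_sphere compact_states)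
  have Kd: "K \<subseteq> dual_ball"
    by (auto simp: K_def rot_def states_UNIV dual_ball_def norm_mult algebra_simps)
  have Kn: "K \<noteq> {}" using ne by (auto simp: K_def intro: exI[of _ 1])
  obtain x h where x: "x \<in> M" "norm (x - x0) \<le> \<epsilon>" and h: "h \<in> K"
    and le: "\<And>f. f \<in> K \<Longrightarrow> Re (f x) \<le> Re (h x)"
    and uniq: "\<And>f y. f \<in> K \<Longrightarrow> Re (f x) = Re (h x) \<Longrightarrow> y \<in> M \<Longrightarrow> f y = h y"
    by (rule exposing_element_near[OF sep M'(1) M(2) Kd Kc Kn x0 \<epsilon>]) (rule that)
  obtain \<nu> g where g: "cmod \<nu> = 1" "g \<in> states UNIV" "h = rot (\<nu>, g)"
    using h by (auto simp: K_def)
  have rotK: "rot (\<mu>, \<psi>) \<in> K" if "cmod \<mu> = 1" "\<psi> \<in> states UNIV" for \<mu> \<psi>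
    using that by (auto simp: K_def)
  have modulus: "cmod (\<psi> x) \<le> Re (h x)" if \<psi>: "\<psi> \<in> states UNIV" for \<psi>
  proof -
    obtain \<mu> where \<mu>: "cmod \<mu> = 1" "\<mu> * \<psi> x = complex_of_real (cmod (\<psi> x))"
      by (rule unimodular_rotation)
    then show ?thesis using le[OF rotK[OF \<mu>(1) \<psi>]] by (simp add: rot_def)
  qed
  have hx: "Re (h x) = cmod (g x)"
    using modulus[OF g(2)] complex_Re_le_cmod[of "h x"] g(1,3) by (simp add: rot_def norm_mult)
  show ?thesis
  proof (rule that[OF x g(2)])
    fix \<psi> :: "'b \<Rightarrow> complex" assume \<psi>: "\<psi> \<in> states UNIV"
    show "cmod (\<psi> x) \<le> cmod (g x)" using modulus[OF \<psi>] hx by simp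
    fix y assume eq: "cmod (\<psi> x) = cmod (g x)" and y: "y \<in> M"
    obtain \<mu> where \<mu>: "cmod \<mu> = 1" "\<mu> * \<psi> x = complex_of_real (cmod (\<psi> x))"
      by (rule unimodular_rotation)
    have same: "\<mu> * \<psi> w = \<nu> * g w" if "w \<in> M" for w
      using uniq[OF rotK[OF \<mu>(1) \<psi>] _ that] \<mu>(2) eq hx g(3) by (simp add: rot_def)
    have "\<mu> = \<nu>" using same[OF M'(2)] \<psi> g(2) by (simp add: states_UNIV)
    moreover have "\<nu> \<noteq> 0" using g(1) by auto
    ultimately show "\<psi> y = g y" using same[OF y] by simp
  qed
qed

section \<open>Separating a pure state from compact sets of states\<close>

lemma convex_functionalsD:
  assumes "convex_functionals D" "f \<in> D" "g \<in> D" "t \<in> {0..1::real}"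
  shows "(\<lambda>x. complex_of_real t * f x + complex_of_real (1 - t) * g x) \<in> D"
  using assms by (simp add: convex_functionals_def)

text \<open>
  Writing convexity without normalising the weights spares the case distinctions for vanishing weights
  when combinations of combinations are regrouped.
\<close>

lemma convex_functionals_cone:
  assumes C: "convex_functionals C" and f: "f \<in> C" "g \<in> C" and pq: "0 \<le> p" "0 \<le> (q::real)"
  obtains h where "h \<in> C"
    "\<And>x. complex_of_real p * f x + complex_of_real q * g x = complex_of_real (p + q) * h x"
proof (cases "p + q = 0")
  case True
  then have "p = 0" "q = 0" using pq by auto
  then show ?thesis using that[OF f(1)] by simp
next
  case False
  define t where "t = p / (p + q)"
  have t: "t \<in> {0..1}" using pq False by (simp add: t_def divide_le_eq)
  have "(p + q) * t = p" "(p + q) * (1 - t) = q" using False by (simp_all add: t_def field_simps)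
  then have *: "complex_of_real p = complex_of_real (p + q) * complex_of_real t"
    "complex_of_real q = complex_of_real (p + q) * complex_of_real (1 - t)"
    by (metis of_real_mult)+
  show ?thesis
  proof (rule that)
    show "(\<lambda>x. complex_of_real t * f x + complex_of_real (1 - t) * g x) \<in> C"
      by (rule convex_functionalsD[OF C f t])
    show "complex_of_real p * f x + complex_of_real q * g x =
      complex_of_real (p + q) * (complex_of_real t * f x + complex_of_real (1 - t) * g x)" for x
      unfolding distrib_left mult.assoc[symmetric] *[symmetric] ..
  qed
qed

lemma states_convex: "convex_functionals (states (UNIV :: 'b::unital_cstar_algebra set))"
  unfolding convex_functionals_def
proof (intro ballI)
  fix f g :: "'b \<Rightarrow> complex" and t :: real
  assume f: "f \<in> states UNIV" and g: "g \<in> states UNIV" and t: "t \<in> {0..1}"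
  have fb: "f \<in> dual_ball" "f 1 = 1" and gb: "g \<in> dual_ball" "g 1 = 1"
    using f g by (auto simp: states_UNIV)
  let ?h = "\<lambda>x. complex_of_real t * f x + complex_of_real (1 - t) * g x"
  have "cmod (?h x) \<le> norm x" for x
  proof -
    have "cmod (?h x) \<le> t * cmod (f x) + (1 - t) * cmod (g x)"
      using norm_triangle_ineq[of "complex_of_real t * f x" "complex_of_real (1 - t) * g x"] t
      by (simp add: norm_mult del: of_real_diff)
    also have "\<dots> \<le> t * norm x + (1 - t) * norm x"
      using t by (intro add_mono mult_left_mono dual_ballD(3) fb gb) auto
    finally show ?thesis by (simp add: algebra_simps)
  qed
  then show "?h \<in> states UNIV"
    unfolding states_UNIV dual_ball_def
    by (auto simp: dual_ballD(1,2)[OF fb(1)] dual_ballD(1,2)[OF gb(1)] fb(2) gb(2) algebra_simps)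
qed

text \<open>
  The union of the segments joining \<open>C\<close> to \<open>D\<close> is a continuous image of \<open>[0,1] \<times> C \<times> D\<close>. A pure state on \<open>M\<close>
  is not the restriction of an interior point of such a segment unless it is already the
  restriction of the end points.
\<close>

lemma hull_of_two_convex_compacts:
  fixes C D :: "('b::unital_cstar_algebra \<Rightarrow> complex) set"
  assumes M: "unital_subspace M" and \<phi>: "\<phi> \<in> pure_states M"
    and C: "C \<subseteq> states UNIV" "compact C" "convex_functionals C" "\<And>\<psi>. \<psi> \<in> C \<Longrightarrow> restrict \<psi> M \<noteq> \<phi>"
    and D: "D \<subseteq> states UNIV" "compact D" "convex_functionals D" "\<And>\<psi>. \<psi> \<in> D \<Longrightarrow> restrict \<psi> M \<noteq> \<phi>"
  obtains H where "H \<subseteq> states UNIV" "compact H" "convex_functionals H"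
    "\<And>\<psi>. \<psi> \<in> H \<Longrightarrow> restrict \<psi> M \<noteq> \<phi>" "C \<subseteq> H" "D \<subseteq> H"
proof (cases "C = {} \<or> D = {}")
  case True
  then show ?thesis using that[of C] that[of D] C D by auto
next
  case False
  define mix where "mix = (\<lambda>(t::real, f, g) x::'b. complex_of_real t * f x + complex_of_real (1 - t) * g x)"
  define H where "H = mix ` ({0..1} \<times> C \<times> D)"
  have mixH: "mix (t, f, g) \<in> H" if "t \<in> {0..1}" "f \<in> C" "g \<in> D" for t f g
    using that by (auto simp: H_def)
  show ?thesis
  proof (rule that[of H])
    show "H \<subseteq> states UNIV"
    proof
      fix h assume "h \<in> H"
      then obtain t f g where h: "h = mix (t, f, g)" "t \<in> {0..1}" "f \<in> C" "g \<in> D"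
        by (auto simp: H_def)
      then have "f \<in> states UNIV" "g \<in> states UNIV" using C(1) D(1) by auto
      then show "h \<in> states UNIV"
        unfolding h(1) mix_def prod.case by (rule convex_functionalsD[OF states_convex _ _ h(2)])
    qed
    have "continuous_on ({0..1} \<times> C \<times> D) mix"
      unfolding mix_def case_prod_beta
    proof (rule continuous_on_coordinatewise_then_product)
      fix x :: 'b
      let ?S = "{0..1::real} \<times> C \<times> D"
      have "continuous_on ?S (\<lambda>p. fst (snd p) x)" "continuous_on ?S (\<lambda>p. snd (snd p) x)"
        by (rule continuous_on_product_then_coordinatewise, intro continuous_intros)+
      then show "continuous_on ?S (\<lambda>p. complex_of_real (fst p) * fst (snd p) x
          + complex_of_real (1 - fst p) * snd (snd p) x)"
        by (intro continuous_intros)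
    qed
    then show "compact H"
      unfolding H_def by (intro compact_continuous_image compact_Times C D compact_Icc)
    show "C \<subseteq> H"
    proof
      fix f assume f: "f \<in> C"
      obtain g where "g \<in> D" using False by auto
      moreover have "mix (1, f, g) = f" by (simp add: mix_def)
      ultimately show "f \<in> H" using mixH[of 1 f g] f by simp
    qed
    show "D \<subseteq> H"
    proof
      fix g assume g: "g \<in> D"
      obtain f where "f \<in> C" using False by auto
      moreover have "mix (0, f, g) = g" by (simp add: mix_def)
      ultimately show "g \<in> H" using mixH[of 0 f g] g by simp
    qed
    show "convex_functionals H"
      unfolding convex_functionals_def
    proof (intro ballI)
      fix u v and s :: real assume "u \<in> H" "v \<in> H" and s: "s \<in> {0..1}"
      then obtain t f g t' f' g' where u: "t \<in> {0..1}" "f \<in> C" "g \<in> D" "u = mix (t, f, g)"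
        and v: "t' \<in> {0..1}" "f' \<in> C" "g' \<in> D" "v = mix (t', f', g')"
        by (auto simp: H_def)
      have nn: "0 \<le> s * t" "0 \<le> (1 - s) * t'" "0 \<le> s * (1 - t)" "0 \<le> (1 - s) * (1 - t')"
        using s u(1) v(1) by auto
      obtain h where h: "h \<in> C" "\<And>x. complex_of_real (s * t) * f x + complex_of_real ((1 - s) * t') * f' x =
          complex_of_real (s * t + (1 - s) * t') * h x"
        using convex_functionals_cone[OF C(3) u(2) v(2) nn(1,2)] by metis
      obtain k where k: "k \<in> D"
        "\<And>x. complex_of_real (s * (1 - t)) * g x + complex_of_real ((1 - s) * (1 - t')) * g' x =
          complex_of_real (s * (1 - t) + (1 - s) * (1 - t')) * k x"
        using convex_functionals_cone[OF D(3) u(3) v(3) nn(3,4)] by metis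
      define T where "T = s * t + (1 - s) * t'"
      have T1: "s * (1 - t) + (1 - s) * (1 - t') = 1 - T" by (simp add: T_def algebra_simps)
      have T: "T \<in> {0..1}" using nn T1 by (simp add: T_def)
      have "(\<lambda>x. complex_of_real s * u x + complex_of_real (1 - s) * v x) = mix (T, h, k)"
      proof
        fix x
        have "complex_of_real s * u x + complex_of_real (1 - s) * v x =
          (complex_of_real (s * t) * f x + complex_of_real ((1 - s) * t') * f' x) +
          (complex_of_real (s * (1 - t)) * g x + complex_of_real ((1 - s) * (1 - t')) * g' x)"
          by (simp add: u(4) v(4) mix_def algebra_simps)
        also have "\<dots> = mix (T, h, k) x" unfolding h(2) k(2) T1 by (simp add: mix_def T_def)
        finally show "complex_of_real s * u x + complex_of_real (1 - s) * v x = mix (T, h, k) x" .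
      qed
      then show "(\<lambda>x. complex_of_real s * u x + complex_of_real (1 - s) * v x) \<in> H"
        using mixH[OF T h(1) k(1)] by simp
    qed
    fix \<psi> assume "\<psi> \<in> H"
    then obtain t f g where \<psi>: "t \<in> {0..1}" "f \<in> C" "g \<in> D" "\<psi> = mix (t, f, g)" by (auto simp: H_def)
    show "restrict \<psi> M \<noteq> \<phi>"
    proof
      assume eq: "restrict \<psi> M = \<phi>"
      consider "t = 0" | "t = 1" | "0 < t" "t < 1" using \<psi>(1) by fastforce
      then show False
      proof cases
        case 1
        then have "\<psi> = g" by (simp add: \<psi>(4) mix_def)
        then show False using D(4)[OF \<psi>(3)] eq by simp
      next
        case 2
        then have "\<psi> = f" by (simp add: \<psi>(4) mix_def)
        then show False using C(4)[OF \<psi>(2)] eq by simp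
      next
        case 3
        have "restrict f M \<in> states M" "restrict g M \<in> states M"
          using \<psi> C(1) D(1) by (auto intro: restrict_state[OF M])
        moreover have "\<forall>x\<in>M. \<phi> x = complex_of_real t * restrict f M x + complex_of_real (1 - t) * restrict g M x"
          unfolding eq[symmetric] by (simp add: \<psi>(4) mix_def)
        ultimately have "restrict f M = \<phi>" using \<phi> 3 unfolding pure_states_def by blast
        then show False using C(4)[OF \<psi>(2)] by simp
      qed
    qed
  qed
qed

lemma hull_of_convex_compacts:
  fixes C :: "'i \<Rightarrow> ('b::unital_cstar_algebra \<Rightarrow> complex) set"
  assumes M: "unital_subspace M" and \<phi>: "\<phi> \<in> pure_states M" and "finite I"
    and C: "\<And>i. i \<in> I \<Longrightarrow> C i \<subseteq> states UNIV" "\<And>i. i \<in> I \<Longrightarrow> compact (C i)"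
      "\<And>i. i \<in> I \<Longrightarrow> convex_functionals (C i)" "\<And>i \<psi>. i \<in> I \<Longrightarrow> \<psi> \<in> C i \<Longrightarrow> restrict \<psi> M \<noteq> \<phi>"
  shows "\<exists>H. H \<subseteq> states UNIV \<and> compact H \<and> convex_functionals H \<and>
    (\<forall>\<psi>\<in>H. restrict \<psi> M \<noteq> \<phi>) \<and> (\<forall>i\<in>I. C i \<subseteq> H)"
  using \<open>finite I\<close> C
proof (induction I rule: finite_induct)
  case empty
  then show ?case by (intro exI[of _ "{}"]) (simp add: convex_functionals_def)
next
  case (insert i I)
  have "\<exists>D. D \<subseteq> states UNIV \<and> compact D \<and> convex_functionals D \<and>
      (\<forall>\<psi>\<in>D. restrict \<psi> M \<noteq> \<phi>) \<and> (\<forall>i\<in>I. C i \<subseteq> D)"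
    by (rule insert.IH, use insert.prems(1) in blast, use insert.prems(2) in blast,
        use insert.prems(3) in blast, use insert.prems(4) in blast)
  then obtain D where D: "D \<subseteq> states UNIV" "compact D" "convex_functionals D"
    "\<And>\<psi>. \<psi> \<in> D \<Longrightarrow> restrict \<psi> M \<noteq> \<phi>" "\<forall>i\<in>I. C i \<subseteq> D"
    by auto
  obtain H where H: "H \<subseteq> states UNIV" "compact H" "convex_functionals H"
    "\<And>\<psi>. \<psi> \<in> H \<Longrightarrow> restrict \<psi> M \<noteq> \<phi>" "C i \<subseteq> H" "D \<subseteq> H"
    using hull_of_two_convex_compacts[OF M \<phi> insert.prems(1-4)[OF insertI1] D(1-4)] by metis
  have "\<forall>j\<in>insert i I. C j \<subseteq> H" using H(5,6) D(5) by blast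
  then show ?case using H(1-4) by blast
qed


section \<open>Density of peaking states\<close>

text \<open>
  The state comes from a peaking element near \<open>x1 + c\<close>. For \<open>g\<close> in \<open>D\<close> the modulus of \<open>g x1 + c\<close> is at most
  \<open>((c + Re (g x1))\<^sup>2 + \<parallel>x1\<parallel>\<^sup>2)\<^sup>1\<^sup>/\<^sup>2\<close>, which for large \<open>c\<close> exceeds \<open>c + Re (g x1)\<close> by less than the gap \<open>\<eta>\<close>.
  So the modulus at \<open>\<Phi>\<close> is larger, and the maximum is attained outside \<open>D\<close>.
\<close>

lemma peaking_state_outside:
  fixes M :: "'b::unital_cstar_algebra set"
  assumes sep: "separable_space (euclidean :: 'b topology)"
    and M: "unital_subspace M" "closed M" and x1: "x1 \<in> M" and \<eta>: "0 < \<eta>"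
    and \<Phi>: "\<Phi> \<in> states UNIV"
    and D: "\<And>f. f \<in> D \<Longrightarrow> Re (f x1) + \<eta> \<le> Re (\<Phi> x1)"
  obtains \<omega> g where "\<omega> \<in> peaking_states M M" "g \<in> states UNIV" "g \<notin> D" "\<And>y. y \<in> M \<Longrightarrow> \<omega> y = g y"
proof -
  have M': "complex_vector.subspace M" "1 \<in> M" using M by (auto simp: unital_subspace_def)
  define R where "R = norm x1"
  \<comment> \<open>Chosen so that \<open>R\<^sup>2 \<le> u \<eta>\<close> holds below for \<open>u = c + b - \<eta>\<close>.\<close>
  define c where "c = R + \<eta> + R\<^sup>2 / \<eta>"
  have c: "0 < c" using \<eta> by (simp add: c_def R_def add_nonneg_pos add_pos_nonneg)
  have state: "cmod (\<psi> x) \<le> norm x" "\<psi> (x1 + c *\<^sub>R 1) = \<psi> x1 + complex_of_real c"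
    "\<psi> (x - y) = \<psi> x - \<psi> y" "\<psi> (k *\<^sub>C x) = k * \<psi> x" if "\<psi> \<in> states UNIV" for \<psi> x y k
    using that by (auto simp: states_UNIV dual_ballD)
  have "x1 + c *\<^sub>R 1 \<in> M"
    using M' x1 by (simp add: scaleR_eq_scaleC complex_vector.subspace_add complex_vector.subspace_scale)
  moreover have "0 < \<eta> / 4" using \<eta> by simp
  moreover have "states (UNIV :: 'b set) \<noteq> {}" using \<Phi> by auto
  ultimately obtain x g where x: "x \<in> M" "norm (x - (x1 + c *\<^sub>R 1)) \<le> \<eta> / 4" and g: "g \<in> states UNIV"
    and le: "\<And>\<psi>. \<psi> \<in> states UNIV \<Longrightarrow> cmod (\<psi> x) \<le> cmod (g x)"
    and uniq: "\<And>\<psi> y. \<psi> \<in> states UNIV \<Longrightarrow> cmod (\<psi> x) = cmod (g x) \<Longrightarrow> y \<in> M \<Longrightarrow> \<psi> y = g y"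
    by (rule modulus_peaking_near[OF sep M]) (rule that)
  have near: "cmod (\<psi> x - (\<psi> x1 + complex_of_real c)) \<le> \<eta> / 4" if \<psi>: "\<psi> \<in> states UNIV" for \<psi>
    using state(1)[OF \<psi>, of "x - (x1 + c *\<^sub>R 1)"] x(2)
    unfolding state(3)[OF \<psi>] state(2)[OF \<psi>] by linarith
  define b where "b = Re (\<Phi> x1)"
  have bR: "- R \<le> b"
    using state(1)[OF \<Phi>, of x1] abs_Re_le_cmod[of "\<Phi> x1"] by (simp add: b_def R_def)
  have "b + c \<le> cmod (\<Phi> x1 + complex_of_real c)"
    using complex_Re_le_cmod[of "\<Phi> x1 + complex_of_real c"] by (simp add: b_def)
  then have "b + c - \<eta> / 4 \<le> cmod (\<Phi> x)"
    using near[OF \<Phi>] norm_triangle_ineq2[of "\<Phi> x1 + complex_of_real c" "\<Phi> x"]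
    by (simp add: norm_minus_commute)
  then have low: "b + c - \<eta> / 4 \<le> cmod (g x)" using le[OF \<Phi>] by linarith
  have "R\<^sup>2 / \<eta> \<ge> 0" using \<eta> by simp
  then have "0 < cmod (g x)" using low bR \<eta> unfolding c_def by linarith
  then have gx: "g x \<noteq> 0" by auto
  have "g \<notin> D"
  proof
    assume "g \<in> D"
    define \<alpha> where "\<alpha> = Re (g x1)"
    have \<alpha>: "\<alpha> + \<eta> \<le> b" using D[OF \<open>g \<in> D\<close>] by (simp add: \<alpha>_def b_def)
    have gR: "cmod (g x1) \<le> R" using state(1)[OF g, of x1] by (simp add: R_def)
    then have \<alpha>R: "- R \<le> \<alpha>" "\<bar>Im (g x1)\<bar> \<le> R"
      using abs_Re_le_cmod[of "g x1"] abs_Im_le_cmod[of "g x1"] by (auto simp: \<alpha>_def)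
    define u where "u = c + b - \<eta>"
    have u: "R\<^sup>2 \<le> u * \<eta>" "0 \<le> u"
    proof -
      have "R\<^sup>2 / \<eta> \<le> u" using bR by (simp add: u_def c_def)
      then show "R\<^sup>2 \<le> u * \<eta>" using \<eta> by (simp add: pos_divide_le_eq)
      show "0 \<le> u" using \<open>R\<^sup>2 / \<eta> \<le> u\<close> \<open>R\<^sup>2 / \<eta> \<ge> 0\<close> by linarith
    qed
    have "0 \<le> \<alpha> + c" using \<alpha>R(1) \<eta> \<open>R\<^sup>2 / \<eta> \<ge> 0\<close> unfolding c_def by linarith
    then have "(\<alpha> + c)\<^sup>2 \<le> u\<^sup>2" using \<alpha> by (intro power_mono) (auto simp: u_def)
    moreover have "(Im (g x1))\<^sup>2 \<le> R\<^sup>2" using \<alpha>R(2) by (simp add: abs_le_square_iff[symmetric])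
    ultimately have "(cmod (g x1 + complex_of_real c))\<^sup>2 \<le> u\<^sup>2 + u * \<eta>"
      using u(1) by (simp add: cmod_power2 \<alpha>_def)
    also have "\<dots> < (u + \<eta> / 2)\<^sup>2" using \<eta> by (simp add: power2_eq_square algebra_simps)
    finally have "cmod (g x1 + complex_of_real c) < u + \<eta> / 2"
      by (rule power_less_imp_less_base) (use u \<eta> in simp)
    moreover have "cmod (g x) \<le> cmod (g x1 + complex_of_real c) + \<eta> / 4"
      using near[OF g] norm_triangle_ineq2[of "g x" "g x1 + complex_of_real c"] by linarith
    ultimately show False using low by (simp add: u_def)
  qed
  define k where "k = inverse (g x)"
  have scaled: "cmod (\<psi> (k *\<^sub>C x)) = cmod (\<psi> x) / cmod (g x)" if "\<psi> \<in> states UNIV" for \<psi>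
    by (simp add: state(4)[OF that] k_def norm_mult norm_inverse divide_inverse mult.commute)
  have gk: "g (k *\<^sub>C x) = 1" using gx by (simp add: state(4)[OF g] k_def)
  have eqs: "\<psi> y = g y" if "\<psi> \<in> states UNIV" "cmod (\<psi> (k *\<^sub>C x)) = 1" "y \<in> M" for \<psi> y
    using that uniq[OF that(1) _ that(3)] scaled[OF that(1)] gx by simp
  have kx: "k *\<^sub>C x \<in> M" using x(1) by (rule complex_vector.subspace_scale[OF M'(1)])
  obtain \<omega> where "\<omega> \<in> peaking_states M M" "\<And>y. y \<in> M \<Longrightarrow> \<omega> y = g y"
  proof (rule peaking_state_exists[OF sep kx g gk])
    fix \<psi> :: "'b \<Rightarrow> complex" assume \<psi>: "\<psi> \<in> states UNIV"
    show "cmod (\<psi> (k *\<^sub>C x)) \<le> 1" using le[OF \<psi>] gx by (simp add: scaled[OF \<psi>] divide_le_eq)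
    show "\<psi> (k *\<^sub>C x) = 1" if "cmod (\<psi> (k *\<^sub>C x)) = 1" using eqs[OF \<psi> that kx] gk by simp
    show "\<psi> y = g y" if "\<psi> (k *\<^sub>C x) = 1" "y \<in> M" for y using eqs[OF \<psi> _ that(2)] that(1) by simp
  qed (rule that)
  then show ?thesis using g \<open>g \<notin> D\<close> that by blast
qed

lemma half_space_slice:
  fixes y :: "'b::unital_cstar_algebra"
  shows "compact {\<psi> \<in> states UNIV. Re (\<psi> y) \<le> r}" "convex_functionals {\<psi> \<in> states UNIV. Re (\<psi> y) \<le> r}"
proof -
  have "compact (states UNIV \<inter> {\<psi> :: 'b \<Rightarrow> complex. Re (\<psi> y) \<le> r})"
    by (intro compact_Int_closed compact_states closed_Collect_le continuous_intros)
  then show "compact {\<psi> \<in> states UNIV. Re (\<psi> y) \<le> r}" by (simp add: Collect_conj_eq)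
  show "convex_functionals {\<psi> \<in> states UNIV. Re (\<psi> y) \<le> r}"
    unfolding convex_functionals_def
  proof (intro ballI CollectI conjI)
    fix f g :: "'b \<Rightarrow> complex" and t :: real
    assume f: "f \<in> {\<psi> \<in> states UNIV. Re (\<psi> y) \<le> r}" and g: "g \<in> {\<psi> \<in> states UNIV. Re (\<psi> y) \<le> r}"
      and t: "t \<in> {0..1}"
    show "(\<lambda>x. complex_of_real t * f x + complex_of_real (1 - t) * g x) \<in> states UNIV"
      using f g t by (intro convex_functionalsD[OF states_convex]) auto
    show "Re (complex_of_real t * f y + complex_of_real (1 - t) * g y) \<le> r"
      using f g t convex_bound_le[of "Re (f y)" r "Re (g y)" t "1 - t"] by simp
  qed
qed

text \<open>
  Outside the neighbourhood of \<open>\<phi>\<close> given by \<open>F\<close> and \<open>e\<close>, some \<open>y\<close> in \<open>F\<close> and some \<open>k\<close> among the fourth roots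
  of unity have \<open>Re (k (\<psi> y - \<phi> y)) \<le> - e / 2\<close>. So the states there lie in finitely many slices whose
  members do not extend \<open>\<phi>\<close>, and it suffices to find a peaking state outside the convex hull.
\<close>

lemma peaking_states_approximate_pure:
  fixes M :: "'b::unital_cstar_algebra set"
  assumes sep: "separable_space (euclidean :: 'b topology)"
    and M: "unital_subspace M" "closed M" and \<phi>: "\<phi> \<in> pure_states M"
    and F: "finite F" "F \<subseteq> M" and e: "0 < e"
  obtains \<omega> where "\<omega> \<in> peaking_states M M" "\<And>y. y \<in> F \<Longrightarrow> cmod (\<omega> y - \<phi> y) < e"
proof -
  have M': "complex_vector.subspace M" "1 \<in> M" using M by (auto simp: unital_subspace_def)
  have "\<phi> \<in> states M" using \<phi> by (simp add: pure_states_def)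
  then obtain \<Phi> where \<Phi>: "\<Phi> \<in> states UNIV" "\<And>x. x \<in> M \<Longrightarrow> \<Phi> x = \<phi> x"
    using state_extension_exists[OF M(1)] by metis
  define I where "I = F \<times> {1, -1, \<i>, -\<i>}"
  define C where "C = (\<lambda>(y, k). {\<psi> \<in> states UNIV. Re (\<psi> (k *\<^sub>C y)) \<le> Re (\<Phi> (k *\<^sub>C y)) - e / 2})"
  have "\<exists>H. H \<subseteq> states UNIV \<and> compact H \<and> convex_functionals H \<and>
      (\<forall>\<psi>\<in>H. restrict \<psi> M \<noteq> \<phi>) \<and> (\<forall>i\<in>I. C i \<subseteq> H)"
  proof (rule hull_of_convex_compacts[OF M(1) \<phi>])
    show "finite I" using F by (simp add: I_def)
    fix i assume i: "i \<in> I"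
    show "C i \<subseteq> states UNIV" by (auto simp: C_def split: prod.splits)
    show "compact (C i)" "convex_functionals (C i)"
      unfolding C_def case_prod_beta by (rule half_space_slice)+
    fix \<psi> assume \<psi>: "\<psi> \<in> C i"
    obtain y k where yk: "i = (y, k)" by (cases i)
    then have "y \<in> M" using i F by (auto simp: I_def)
    then have "k *\<^sub>C y \<in> M" by (rule complex_vector.subspace_scale[OF M'(1)])
    moreover have "\<psi> (k *\<^sub>C y) \<noteq> \<Phi> (k *\<^sub>C y)" using \<psi> e by (auto simp: C_def yk)
    ultimately show "restrict \<psi> M \<noteq> \<phi>" using \<Phi>(2) by (metis restrict_apply')
  qed
  then obtain D where D: "D \<subseteq> states UNIV" "compact D" "convex_functionals D"
    "\<And>\<psi>. \<psi> \<in> D \<Longrightarrow> restrict \<psi> M \<noteq> \<phi>" "\<And>i. i \<in> I \<Longrightarrow> C i \<subseteq> D" by auto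
  have "\<exists>y\<in>M. f y \<noteq> \<Phi> y" if "f \<in> D" for f
  proof (rule ccontr)
    assume "\<not> ?thesis"
    then have "restrict f M = restrict \<phi> M" using \<Phi>(2) by (intro restrict_ext) auto
    also have "\<dots> = \<phi>" using \<open>\<phi> \<in> states M\<close> by (simp add: states_def extensional_restrict)
    finally show False using D(4)[OF that] by simp
  qed
  moreover have "D \<subseteq> dual_ball" "\<Phi> \<in> dual_ball" using D(1) \<Phi>(1) by (auto simp: states_UNIV)
  ultimately obtain x1 \<eta> where x1: "x1 \<in> M" "0 < \<eta>" "\<And>f. f \<in> D \<Longrightarrow> Re (f x1) + \<eta> \<le> Re (\<Phi> x1)"
    using strict_separation[OF sep M'(1) M(2) _ D(2,3)] by metis
  obtain \<omega> g where \<omega>: "\<omega> \<in> peaking_states M M" "g \<in> states UNIV" "g \<notin> D" "\<And>y. y \<in> M \<Longrightarrow> \<omega> y = g y"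
    using peaking_state_outside[OF sep M x1(1,2) \<Phi>(1), of D] x1(3) by metis
  show ?thesis
  proof (rule that[OF \<omega>(1)])
    fix y assume y: "y \<in> F"
    define z where "z = g y - \<Phi> y"
    have "- e / 2 < Re (k * z)" if k: "k \<in> {1, -1, \<i>, -\<i>}" for k
    proof (rule ccontr)
      assume "\<not> ?thesis"
      then have "Re (g (k *\<^sub>C y)) \<le> Re (\<Phi> (k *\<^sub>C y)) - e / 2"
        using \<omega>(2) \<Phi>(1) by (simp add: z_def states_UNIV dual_ballD algebra_simps)
      then have "g \<in> C (y, k)" using \<omega>(2) by (simp add: C_def)
      moreover have "(y, k) \<in> I" using y k by (simp add: I_def)
      ultimately show False using D(5) \<omega>(3) by blast
    qed
    from this[of 1] this[of "-1"] this[of \<i>] this[of "-\<i>"]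
    have "\<bar>Re z\<bar> < e / 2" "\<bar>Im z\<bar> < e / 2" by auto
    then have "cmod z < e" using cmod_le[of z] by linarith
    then show "cmod (\<omega> y - \<phi> y) < e" using y F(2) \<omega>(4) \<Phi>(2) by (auto simp: z_def)
  qed
qed

lemma pure_states_subset_closure_peaking:
  fixes M :: "'b::unital_cstar_algebra set"
  assumes sep: "separable_space (euclidean :: 'b topology)" and M: "unital_subspace M" "closed M"
  shows "pure_states M \<subseteq> weak_star M closure_of ((\<lambda>\<omega>. restrict \<omega> M) ` peaking_states M M)"
proof
  fix \<phi> assume \<phi>: "\<phi> \<in> pure_states M"
  then have \<phi>s: "\<phi> \<in> states M" by (simp add: pure_states_def)
  show "\<phi> \<in> weak_star M closure_of ((\<lambda>\<omega>. restrict \<omega> M) ` peaking_states M M)"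
    unfolding in_closure_of
  proof (intro conjI allI impI)
    show "\<phi> \<in> topspace (weak_star M)"
      using \<phi>s by (auto simp: weak_star_def states_def PiE_def)
    fix T assume T: "\<phi> \<in> T \<and> openin (weak_star M) T"
    then obtain W where W: "openin (product_topology (\<lambda>_. euclidean) M) W" "T = W \<inter> states M"
      by (auto simp: weak_star_def openin_subtopology)
    then obtain U where U: "finite {i \<in> M. U i \<noteq> (UNIV :: complex set)}" "\<And>i. i \<in> M \<Longrightarrow> open (U i)"
      "\<phi> \<in> Pi\<^sub>E M U" "Pi\<^sub>E M U \<subseteq> W"
      using T by (fastforce simp: openin_product_topology_alt)
    define F where "F = {i \<in> M. U i \<noteq> UNIV}"
    have "\<exists>e>0. ball (\<phi> i) e \<subseteq> U i" if "i \<in> F" for i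
      using that U(2)[of i] U(3) by (auto simp: F_def open_contains_ball)
    then obtain r where r: "\<And>i. i \<in> F \<Longrightarrow> 0 < r i \<and> ball (\<phi> i) (r i) \<subseteq> U i" by metis
    define e where "e = Min (insert 1 (r ` F))"
    have fin: "finite (insert 1 (r ` F))" using U(1) by (simp add: F_def)
    have e: "0 < e" using fin r by (auto simp: e_def)
    have er: "e \<le> r i" if "i \<in> F" for i using fin that by (auto simp: e_def)
    obtain \<omega> where \<omega>: "\<omega> \<in> peaking_states M M" "\<And>y. y \<in> F \<Longrightarrow> cmod (\<omega> y - \<phi> y) < e"
      using peaking_states_approximate_pure[OF sep M \<phi> _ _ e, of F] U(1) by (auto simp: F_def)
    have "restrict \<omega> M \<in> Pi\<^sub>E M U"
    proof (rule PiE_I)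
      fix i assume i: "i \<in> M"
      show "restrict \<omega> M i \<in> U i"
      proof (cases "i \<in> F")
        case True
        then have "\<omega> i \<in> ball (\<phi> i) (r i)"
          using \<omega>(2)[OF True] er[OF True] by (simp add: dist_norm norm_minus_commute)
        then show ?thesis using r[OF True] i by auto
      qed (use i in \<open>auto simp: F_def\<close>)
    qed simp
    moreover have "restrict \<omega> M \<in> states M"
      using \<omega>(1) by (intro restrict_state M) (simp add: peaking_states_def pure_states_def)
    ultimately show "\<exists>y. y \<in> (\<lambda>\<omega>. restrict \<omega> M) ` peaking_states M M \<and> y \<in> T"
      using \<omega>(1) U(4) W(2) by blast
  qed
qed

section \<open>Norming squares by peaking states\<close>

text \<open>
  The role of the algebra structure is in \<open>determined\<close>: a state with value \<open>1\<close> at \<open>b\<^sup>* b\<close> satisfies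
  \<open>\<psi> y = \<psi> (b\<^sup>* (b y))\<close>, and \<open>b y \<in> A\<close>, where \<open>w \<mapsto> \<psi> (b\<^sup>* w)\<close> coincides with the one contractive
  functional that is norming for \<open>a\<close>.
\<close>

lemma squares_peaking_state_near:
  fixes A :: "'b::unital_cstar_algebra set"
  assumes sep: "separable_space (euclidean :: 'b topology)"
    and A: "unital_subalgebra A" "closed A" and a0: "a0 \<in> A" and \<epsilon>: "0 < \<epsilon>" "\<epsilon> < norm a0"
  obtains a \<omega> where "a \<in> A" "norm (a - a0) \<le> \<epsilon>" "\<omega> \<in> peaking_states (squares A) A"
    "\<omega> (adj a * a) = complex_of_real ((norm a)\<^sup>2)"
proof -
  have A': "complex_vector.subspace A" "1 \<in> A" "\<And>x y. x \<in> A \<Longrightarrow> y \<in> A \<Longrightarrow> x * y \<in> A"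
    using A by (auto simp: unital_subalgebra_def unital_subspace_def)
  have ne: "dual_ball \<noteq> ({} :: ('b \<Rightarrow> complex) set)" using zero_in_dual_ball by blast
  obtain a f where a: "a \<in> A" "norm (a - a0) \<le> \<epsilon>" and f: "f \<in> dual_ball"
    and uniq: "\<And>h y. h \<in> dual_ball \<Longrightarrow> Re (h a) = Re (f a) \<Longrightarrow> y \<in> A \<Longrightarrow> h y = f y"
    and le: "\<And>h. h \<in> dual_ball \<Longrightarrow> Re (h a) \<le> Re (f a)"
    by (rule exposing_element_near[OF sep A'(1) A(2) subset_refl compact_dual_ball ne a0 \<epsilon>(1)]) (rule that)
  have "a \<noteq> 0" using a(2) \<epsilon>(2) by auto
  then have na: "norm a > 0" by simp
  define b where "b = (1 / norm a) *\<^sub>R a"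
  have nb: "norm b = 1" and ab: "a = norm a *\<^sub>R b" using na by (simp_all add: b_def)
  have bA: "b \<in> A" using a(1) by (simp add: b_def scaleR_eq_scaleC complex_vector.subspace_scale[OF A'(1)])
  define x where "x = adj b * b"
  have nx: "norm x = 1" using nb by (simp add: x_def cstar_identity)
  have bound: "cmod (\<psi> x) \<le> 1" if "\<psi> \<in> states UNIV" for \<psi>
    using that nx dual_ballD(3)[of \<psi> x] by (auto simp: states_UNIV)
  have real: "\<psi> x = 1" if \<psi>: "\<psi> \<in> states UNIV" and "cmod (\<psi> x) = 1" for \<psi>
    using state_positive[OF \<psi>, of b] that(2) by (auto simp: x_def[symmetric] cmod_def complex_eq_iff)
  have determined: "\<psi> y = f (b * y)" if \<psi>: "\<psi> \<in> states UNIV" and \<psi>x: "\<psi> x = 1" and y: "y \<in> A" for \<psi> y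
  proof -
    have db: "\<psi> \<in> dual_ball" "\<psi> 1 = 1" using \<psi> by (auto simp: states_UNIV)
    define h where "h = (\<lambda>w. \<psi> (adj b * w))"
    have "cmod (h w) \<le> norm w" for w
      unfolding h_def using dual_ballD(3)[OF db(1), of "adj b * w"] norm_mult_ineq[of "adj b" w] nb by simp
    then have h: "h \<in> dual_ball"
      by (simp add: dual_ball_def h_def distrib_left mult_scaleC_right dual_ballD(1,2)[OF db(1)])
    have "h b = 1" using \<psi>x by (simp add: h_def x_def)
    then have ha: "Re (h a) = norm a" using dual_ballD(7)[OF h, of "norm a" b] ab by simp
    then have "Re (h a) = Re (f a)"
      using le[OF h] dual_ballD(3)[OF f, of a] complex_Re_le_cmod[of "f a"] by linarith
    then have h_eq: "h (b * y) = f (b * y)" using uniq[OF h _ A'(3)[OF bA y]] by simp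
    have adjx: "adj x = x" by (simp add: x_def adj_mult adj_adj)
    \<comment> \<open>Expanding \<open>\<psi> ((1 - x)\<^sup>* (1 - x))\<close> leaves \<open>\<psi> (x\<^sup>2) - 1 \<le> 0\<close>, so \<open>1 - x\<close> is null for \<open>\<psi>\<close>.\<close>
    have "cmod (\<psi> (x * x)) \<le> 1"
      using dual_ballD(3)[OF db(1), of "x * x"] norm_mult_ineq[of x x] nx by simp
    then have "Re (\<psi> (x * x)) \<le> 1" using complex_Re_le_cmod[of "\<psi> (x * x)"] by linarith
    moreover have "adj (1 - x) * (1 - x) = 1 - x - x + x * x" by (simp add: adj_diff adjx algebra_simps)
    ultimately have "Re (\<psi> (adj (1 - x) * (1 - x))) \<le> 0"
      by (simp add: dual_ballD(1,6)[OF db(1)] db(2) \<psi>x)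
    then have "\<psi> (adj (1 - x) * y) = 0" by (rule state_null_left[OF \<psi>])
    then have "\<psi> y = \<psi> (x * y)" by (simp add: adj_diff adjx left_diff_distrib dual_ballD(6)[OF db(1)])
    then show ?thesis using h_eq by (simp add: h_def x_def mult.assoc)
  qed
  obtain \<psi>0 where \<psi>0: "\<psi>0 \<in> states UNIV" "\<psi>0 x = 1" unfolding x_def by (rule norming_state_exists[OF nb])
  have xs: "x \<in> squares A" using bA by (auto simp: x_def squares_def)
  obtain \<omega> where \<omega>: "\<omega> \<in> peaking_states (squares A) A" "\<omega> x = 1"
  proof (rule peaking_state_exists[OF sep xs \<psi>0])
    show "\<psi> y = \<psi>0 y" if "\<psi> \<in> states UNIV" "\<psi> x = 1" "y \<in> A" for \<psi> y
      using determined[OF that] determined[OF \<psi>0 that(3)] by simp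
  qed (use bound real that in auto)
  have "adj a * a = ((norm a)\<^sup>2) *\<^sub>R x"
    by (subst (1 2) ab) (simp add: x_def adj_scaleR power2_eq_square)
  moreover have "\<omega> \<in> dual_ball" using \<omega>(1) by (simp add: peaking_states_def pure_states_def states_UNIV)
  ultimately have "\<omega> (adj a * a) = complex_of_real ((norm a)\<^sup>2)"
    using \<omega>(2) dual_ballD(7)[of \<omega> "(norm a)\<^sup>2" x] by simp
  then show ?thesis using that[OF a \<omega>(1)] by blast
qed

lemma SUP_squares_peaking:
  fixes A :: "'b::unital_cstar_algebra set"
  assumes sep: "separable_space (euclidean :: 'b topology)"
    and A: "unital_subalgebra A" "closed A" and a: "a \<in> A"
  shows "(SUP \<omega>\<in>peaking_states (squares A) A. ereal (Re (\<omega> (adj a * a)))) = ereal ((norm a)\<^sup>2)"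
    (is "?S = _")
proof (rule antisym)
  have db: "\<omega> \<in> dual_ball" if "\<omega> \<in> peaking_states (squares A) A" for \<omega>
    using that by (simp add: peaking_states_def pure_states_def states_UNIV)
  show "?S \<le> ereal ((norm a)\<^sup>2)"
  proof (rule SUP_least)
    fix \<omega> assume "\<omega> \<in> peaking_states (squares A) A"
    from dual_ballD(3)[OF db[OF this], of "adj a * a"]
    show "ereal (Re (\<omega> (adj a * a))) \<le> ereal ((norm a)\<^sup>2)"
      using complex_Re_le_cmod[of "\<omega> (adj a * a)"] by (simp add: cstar_identity)
  qed
  show "ereal ((norm a)\<^sup>2) \<le> ?S"
  proof (cases "a = 0")
    case True
    have "1 \<in> A" using A by (simp add: unital_subalgebra_def unital_subspace_def)
    then obtain \<omega> where \<omega>: "\<omega> \<in> peaking_states (squares A) A"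
      using squares_peaking_state_near[OF sep A, of 1 "1/2"] by auto
    show ?thesis by (rule SUP_upper2[OF \<omega>]) (simp add: True dual_ballD(4)[OF db[OF \<omega>]])
  next
    case False
    define n where "n = norm a"
    have n: "n > 0" using False by (simp add: n_def)
    show ?thesis
    proof (rule ereal_le_epsilon2)
      fix e :: real assume e: "0 < e"
      \<comment> \<open>The error in passing from \<open>c\<close> back to \<open>a\<close> will be at most \<open>4 n \<delta>\<close>.\<close>
      define \<delta> where "\<delta> = min (min 1 (n / 2)) (e / (4 * n + 1))"
      have "0 < e / (4 * n + 1)" using n e by simp
      then have \<delta>: "0 < \<delta>" "\<delta> \<le> 1" "\<delta> < n" using n unfolding \<delta>_def by linarith+
      have "\<delta> \<le> e / (4 * n + 1)" by (simp add: \<delta>_def)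
      then have \<delta>e: "\<delta> * (4 * n + 1) \<le> e" using n by (subst (asm) pos_le_divide_eq) auto
      obtain c \<omega> where c: "c \<in> A" "norm (c - a) \<le> \<delta>" and \<omega>: "\<omega> \<in> peaking_states (squares A) A"
        and \<omega>c: "\<omega> (adj c * c) = complex_of_real ((norm c)\<^sup>2)"
        using squares_peaking_state_near[OF sep A a \<delta>(1)] \<delta>(3) by (auto simp: n_def)
      have nc: "norm c \<le> n + \<delta>" "n - \<delta> \<le> norm c"
        using norm_triangle_ineq2[of c a] norm_triangle_ineq2[of a c] c(2)
        by (auto simp: n_def norm_minus_commute)
      have "adj c * c - adj a * a = adj c * (c - a) + adj (c - a) * a"
        by (simp add: algebra_simps adj_diff)
      also have "norm \<dots> \<le> norm c * norm (c - a) + norm (c - a) * norm a"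
        by (rule norm_triangle_mono) (metis norm_mult_ineq norm_adj)+
      also have "\<dots> \<le> (n + \<delta>) * \<delta> + \<delta> * n"
        using nc(1) c(2) n \<delta>(1) by (intro add_mono mult_mono) (auto simp: n_def)
      finally have "norm (adj c * c - adj a * a) \<le> (n + \<delta>) * \<delta> + \<delta> * n" .
      then have "Re (\<omega> (adj c * c)) - Re (\<omega> (adj a * a)) \<le> (n + \<delta>) * \<delta> + \<delta> * n"
        using dual_ballD(3)[OF db[OF \<omega>], of "adj c * c - adj a * a"]
          complex_Re_le_cmod[of "\<omega> (adj c * c - adj a * a)"]
        by (simp add: dual_ballD(6)[OF db[OF \<omega>]])
      moreover have "(n - \<delta>)\<^sup>2 \<le> (norm c)\<^sup>2" using nc(2) \<delta>(3) by (intro power_mono) auto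
      ultimately have "(n - \<delta>)\<^sup>2 \<le> Re (\<omega> (adj a * a)) + ((n + \<delta>) * \<delta> + \<delta> * n)"
        using \<omega>c by simp
      then have "n\<^sup>2 \<le> Re (\<omega> (adj a * a)) + 4 * n * \<delta>"
        by (simp add: power2_eq_square algebra_simps)
      also have "\<dots> \<le> Re (\<omega> (adj a * a)) + e" using \<delta>e \<delta>(1) by (simp add: algebra_simps)
      finally have "ereal (n\<^sup>2) \<le> ereal (Re (\<omega> (adj a * a))) + ereal e" by simp
      also have "\<dots> \<le> ?S + ereal e" by (intro add_right_mono SUP_upper \<omega>)
      finally show "ereal ((norm a)\<^sup>2) \<le> ?S + ereal e" by (simp add: n_def)
    qed
  qed
qed

theorem theorem1:
  assumes "separable_space (euclidean :: 'b::unital_cstar_algebra topology)"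
  shows "(\<forall>M :: 'b set. unital_subspace M \<and> closed M \<longrightarrow>
            (\<lambda>\<omega>. restrict \<omega> M) ` peaking_states M M \<subseteq> pure_states M \<and>
            pure_states M \<subseteq> weak_star M closure_of ((\<lambda>\<omega>. restrict \<omega> M) ` peaking_states M M)) \<and>
         (\<forall>A :: 'b set. unital_subalgebra A \<and> closed A \<longrightarrow>
            (\<forall>a\<in>A. (SUP \<omega>\<in>peaking_states (squares A) A. ereal (Re (\<omega> (adj a * a)))) =
                     ereal ((norm a)\<^sup>2)))"
  using restrict_peaking_state_pure pure_states_subset_closure_peaking[OF assms]
    SUP_squares_peaking[OF assms] by blast

end
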